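(* Let $N\ge 2$ and $\xi=e^{\pi i/N}$. Let $\mathcal W_\xi$ be the extended Weyl algebra at $q=\xi$, let $\mathcal Z_0^{\mathcal W}\subset\mathcal W_\xi$ be its central subalgebra generated by $x^{\pm N},y^{\pm N},z^{\pm N}$, and let $\mathcal R^{\mathcal W}$ be the automorphism described in the context. Identify a character $\chi:\mathcal Z_0^{\mathcal W}\to\mathbb C$ with the triple $(a,b,m)=(\chi(x^N),\chi(y^N),\chi(z^N))\in(\mathbb C\setminus\{0\})^3$. Then the braiding map $B$ (defined in the context) is characterized by $$B(\chi_1,\chi_2)=(\chi_{2'},\chi_{1'})\quad\text{exactly when}\quad \chi_{1'}\otimes\chi_{2'}=(\chi_1\otimes\chi_2)\circ(\mathcal R^{\mathcal W})^{-1}$$ as characters of $\mathcal Z_0^{\mathcal W}\otimes\mathcal Z_0^{\mathcal W}$. (Both sides are rational in $(\chi_1,\chi_2)$; the equivalence is asserted for $\chi_1,\chi_2,\chi_{1'},\chi_{2'}\in(\mathbb C\setminus\{0\})^3$ at which the rational expressions involved are defined.)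
   Context: **Braiding map.** For $\chi_i=(a_i,b_i,m_i)\in(\mathbb C\setminus\{0\})^3$, $i=1,2$, the birational map $B(\chi_1,\chi_2)=(\chi_{2'},\chi_{1'})$ is given by $m_{1'}=m_1$, $m_{2'}=m_2$, $$a_{1'}=a_1A^{-1},\quad a_{2'}=a_2A,\quad A=1-\frac{m_1b_1}{b_2}\Bigl(1-\frac{a_1}{m_1}\Bigr)\Bigl(1-\frac1{m_2a_2}\Bigr),$$ $$b_{1'}=\frac{m_2b_2}{m_1}\Bigl(1-m_2a_2\Bigl(1-\frac{b_2}{m_1b_1}\Bigr)\Bigr)^{-1},\qquad b_{2'}=b_1\Bigl(1-\frac{m_1}{a_1}\Bigl(1-\frac{b_2}{m_1b_1}\Bigr)\Bigr).$$ **Extended Weyl algebra.** $\mathcal W_q$ is the algebra over $\mathbb C[q,q^{-1}]$ generated by a central invertible element $z$ and invertible elements $x,y$ with $xy=q^2yx$; $\mathcal W_\xi$ is its specialization at $q=\xi$. **The map $\mathcal R^{\mathcal W}$.** Write $x_1=x\otimes1$, $x_2=1\otimes x$, etc. in $\mathcal W_q^{\otimes2}$. $\mathcal R^{\mathcal W}$ is the algebra map, with values in the skew field of fractions, characterized by $$\mathcal R^{\mathcal W}(x_1)=x_1g,\quad \mathcal R^{\mathcal W}(x_2)=g^{-1}x_2,\quad \mathcal R^{\mathcal W}(z_1)=z_1,\quad \mathcal R^{\mathcal W}(z_2)=z_2,$$ $$\mathcal R^{\mathcal W}(y_1^{-1})=y_2^{-1}+(y_1^{-1}-z_2^{-1}y_2^{-1})x_2^{-1},\qquad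 \mathcal R^{\mathcal W}(y_2)=\frac{z_1}{z_2}y_1+(y_2-z_2^{-1}y_1)x_1,$$ $$g=1-x_1^{-1}y_1(z_1-x_1)y_2^{-1}(x_2-z_2^{-1}).$$ (It corresponds to conjugation by the universal $R$-matrix of quantum $\mathfrak{sl}_2$ under the embedding $K\mapsto x$, $E\mapsto qy(z-x)$, $F\mapsto y^{-1}(1-z^{-1}x^{-1})$ of quantum $\mathfrak{sl}_2$ into $\mathcal W_q$.) At $q=\xi$ these formulas restrict to an automorphism of the fraction field of $\mathcal Z_0^{\mathcal W}\otimes\mathcal Z_0^{\mathcal W}$, and $(\chi_1\otimes\chi_2)\circ(\mathcal R^{\mathcal W})^{-1}$ means: apply the inverse of this field automorphism to an element of $\mathcal Z_0^{\mathcal W}\otimes\mathcal Z_0^{\mathcal W}$ and evaluate the resulting rational function at the point $(\chi_1,\chi_2)$. *)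

theory Defs
  imports Complex_Main "HOL-Library.Poly_Mapping" "HOL-Library.Product_Plus"
begin

section \<open>The extended Weyl algebra and its tensor square\<close>

text \<open>
  Both algebras are written in a basis of normally ordered monomials, so an element is a
  finitely supported function from exponents to complex numbers.  Basis vectors multiply as
  $e_g e_h = \beta(g,h) e_{g+h}$.  The multiplication \<open>*\<close> that the type already carries is the
  untwisted one and is never used.
\<close>

definition twisted_mult ::
  "('g::ab_group_add \<Rightarrow> 'g \<Rightarrow> complex) \<Rightarrow> ('g \<Rightarrow>\<^sub>0 complex) \<Rightarrow> ('g \<Rightarrow>\<^sub>0 complex) \<Rightarrow> ('g \<Rightarrow>\<^sub>0 complex)" where
  "twisted_mult \<beta> f g =
     (\<Sum>i\<in>Poly_Mapping.keys f. \<Sum>j\<in>Poly_Mapping.keys g.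
        Poly_Mapping.single (i + j) (\<beta> i j * Poly_Mapping.lookup f i * Poly_Mapping.lookup g j))"

type_synonym weyl_exp = "int \<times> int \<times> int"
type_synonym weyl = "weyl_exp \<Rightarrow>\<^sub>0 complex"
type_synonym weyl2 = "(weyl_exp \<times> weyl_exp) \<Rightarrow>\<^sub>0 complex"

text \<open>
  The exponent \<open>(i, j, k)\<close> stands for $x^i y^j z^k$.  From $xy = q^2 yx$ one gets
  $y^j x^{i'} = q^{-2 j i'} x^{i'} y^j$, which is the twist below.  That this is the algebra given by
  the generators and relations is \<open>weyl_relations\<close> together with \<open>weyl_universal\<close>.
\<close>

definition weyl_twist :: "complex \<Rightarrow> weyl_exp \<Rightarrow> weyl_exp \<Rightarrow> complex" where
  "weyl_twist q = (\<lambda>(i, j, k) (i', j', k'). q powi (- 2 * j * i'))"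

definition weyl_mult :: "complex \<Rightarrow> weyl \<Rightarrow> weyl \<Rightarrow> weyl" where
  "weyl_mult q = twisted_mult (weyl_twist q)"

abbreviation weyl_monom :: "int \<Rightarrow> int \<Rightarrow> int \<Rightarrow> weyl" where
  "weyl_monom i j k \<equiv> Poly_Mapping.single (i, j, k) 1"

abbreviation weyl_const :: "complex \<Rightarrow> weyl" where
  "weyl_const c \<equiv> Poly_Mapping.single 0 c"

definition weyl2_mult :: "complex \<Rightarrow> weyl2 \<Rightarrow> weyl2 \<Rightarrow> weyl2" where
  "weyl2_mult q =
     twisted_mult (\<lambda>(g1, g2) (h1, h2). weyl_twist q g1 h1 * weyl_twist q g2 h2)"

abbreviation weyl2_const :: "complex \<Rightarrow> weyl2" where
  "weyl2_const c \<equiv> Poly_Mapping.single 0 c"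

definition weyl_tensor :: "weyl \<Rightarrow> weyl \<Rightarrow> weyl2" (infixr "\<otimes>\<^sub>W" 75) where
  "u \<otimes>\<^sub>W v =
     (\<Sum>g\<in>Poly_Mapping.keys u. \<Sum>h\<in>Poly_Mapping.keys v.
        Poly_Mapping.single (g, h) (Poly_Mapping.lookup u g * Poly_Mapping.lookup v h))"


subsection \<open>Algebra laws and the presentation\<close>

lemma poly_mapping_expand:
  "f = (\<Sum>i\<in>Poly_Mapping.keys f. Poly_Mapping.single i (Poly_Mapping.lookup f i))"
proof (rule poly_mapping_eqI)
  fix k
  have "(\<Sum>i\<in>Poly_Mapping.keys f. Poly_Mapping.lookup (Poly_Mapping.single i (Poly_Mapping.lookup f i)) k)
      = (\<Sum>i\<in>Poly_Mapping.keys f. if k = i then Poly_Mapping.lookup f i else 0)"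
    by (intro sum.cong) (auto simp: lookup_single when_def)
  also have "\<dots> = Poly_Mapping.lookup f k"
    by (simp add: sum.delta' in_keys_iff)
  finally show "Poly_Mapping.lookup f k =
      Poly_Mapping.lookup (\<Sum>i\<in>Poly_Mapping.keys f. Poly_Mapping.single i (Poly_Mapping.lookup f i)) k"
    by (simp add: lookup_sum)
qed

lemma poly_mapping_linear_induct [case_names single add]:
  fixes f :: "'g::zero \<Rightarrow>\<^sub>0 'b::comm_monoid_add"
  assumes s: "\<And>i c. P (Poly_Mapping.single i c)" and a: "\<And>f g. P f \<Longrightarrow> P g \<Longrightarrow> P (f + g)"
  shows "P f"
proof -
  have "P (\<Sum>i\<in>A. Poly_Mapping.single i (Poly_Mapping.lookup f i))" if "finite A" for A
    using that
  proof (induction A rule: finite_induct)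
    case empty
    show ?case using s[of 0 0] by simp
  next
    case (insert x F)
    then show ?case by (simp add: a s)
  qed
  then show ?thesis by (subst poly_mapping_expand) simp
qed

lemma bilinear_sum_superset:
  assumes "finite A" "finite B" "Poly_Mapping.keys f \<subseteq> A" "Poly_Mapping.keys g \<subseteq> B"
    and "\<And>i j b. F i j 0 b = (0::'c::comm_monoid_add)" and "\<And>i j a. F i j a 0 = 0"
  shows "(\<Sum>i\<in>Poly_Mapping.keys f. \<Sum>j\<in>Poly_Mapping.keys g.
            F i j (Poly_Mapping.lookup f i) (Poly_Mapping.lookup g j))
       = (\<Sum>i\<in>A. \<Sum>j\<in>B. F i j (Poly_Mapping.lookup f i) (Poly_Mapping.lookup g j))"
proof -
  have "(\<Sum>j\<in>Poly_Mapping.keys g. F i j (Poly_Mapping.lookup f i) (Poly_Mapping.lookup g j))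
      = (\<Sum>j\<in>B. F i j (Poly_Mapping.lookup f i) (Poly_Mapping.lookup g j))" for i
    using assms by (intro sum.mono_neutral_left) (auto simp: in_keys_iff)
  then have "(\<Sum>i\<in>Poly_Mapping.keys f. \<Sum>j\<in>Poly_Mapping.keys g.
            F i j (Poly_Mapping.lookup f i) (Poly_Mapping.lookup g j))
       = (\<Sum>i\<in>Poly_Mapping.keys f. \<Sum>j\<in>B.
            F i j (Poly_Mapping.lookup f i) (Poly_Mapping.lookup g j))"
    by simp
  also have "\<dots> = (\<Sum>i\<in>A. \<Sum>j\<in>B. F i j (Poly_Mapping.lookup f i) (Poly_Mapping.lookup g j))"
    using assms by (intro sum.mono_neutral_left) (auto simp: in_keys_iff)
  finally show ?thesis .
qed

lemma twisted_mult_superset: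
  assumes "finite A" "finite B" "Poly_Mapping.keys f \<subseteq> A" "Poly_Mapping.keys g \<subseteq> B"
  shows "twisted_mult \<beta> f g =
     (\<Sum>i\<in>A. \<Sum>j\<in>B.
        Poly_Mapping.single (i + j) (\<beta> i j * Poly_Mapping.lookup f i * Poly_Mapping.lookup g j))"
  unfolding twisted_mult_def
  by (rule bilinear_sum_superset
        [where F = "\<lambda>i j a b. Poly_Mapping.single (i + j) (\<beta> i j * a * b)", OF assms]) simp_all

lemma twisted_mult_single:
  "twisted_mult \<beta> (Poly_Mapping.single i a) (Poly_Mapping.single j b)
     = Poly_Mapping.single (i + j) (\<beta> i j * a * b)"
  by (subst twisted_mult_superset[of "{i}" "{j}"]) (auto split: if_splits)

lemma twisted_mult_add_left:
  "twisted_mult \<beta> (f + g) h = twisted_mult \<beta> f h + twisted_mult \<beta> g h"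
proof -
  let ?A = "Poly_Mapping.keys f \<union> Poly_Mapping.keys g" and ?B = "Poly_Mapping.keys h"
  have "Poly_Mapping.keys (f + g) \<subseteq> ?A" by (rule keys_add)
  then show ?thesis
    by (subst (1 2 3) twisted_mult_superset[of ?A ?B])
       (auto simp: lookup_add distrib_left distrib_right single_add sum.distrib)
qed

lemma twisted_mult_add_right:
  "twisted_mult \<beta> h (f + g) = twisted_mult \<beta> h f + twisted_mult \<beta> h g"
proof -
  let ?A = "Poly_Mapping.keys f \<union> Poly_Mapping.keys g" and ?B = "Poly_Mapping.keys h"
  have "Poly_Mapping.keys (f + g) \<subseteq> ?A" by (rule keys_add)
  then show ?thesis
    by (subst (1 2 3) twisted_mult_superset[of ?B ?A])
       (auto simp: lookup_add distrib_left distrib_right single_add sum.distrib)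
qed

lemma twisted_mult_assoc:
  assumes "\<And>i j k. \<beta> (i + j) k = \<beta> i k * \<beta> j k" "\<And>i j k. \<beta> i (j + k) = \<beta> i j * \<beta> i k"
  shows "twisted_mult \<beta> (twisted_mult \<beta> f g) h = twisted_mult \<beta> f (twisted_mult \<beta> g h)"
proof (induction f rule: poly_mapping_linear_induct)
  case (single i a)
  show ?case
  proof (induction g rule: poly_mapping_linear_induct)
    case (single j b)
    show ?case
      by (induction h rule: poly_mapping_linear_induct)
         (simp_all add: twisted_mult_single twisted_mult_add_right assms add.assoc mult_ac)
  qed (simp add: twisted_mult_add_left twisted_mult_add_right)
qed (simp add: twisted_mult_add_left)

lemma weyl_mult_single:
  "weyl_mult q (Poly_Mapping.single (i, j, k) a) (Poly_Mapping.single (i', j', k') b)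
     = Poly_Mapping.single (i + i', j + j', k + k') (q powi (- 2 * j * i') * a * b)"
  by (simp add: weyl_mult_def twisted_mult_single weyl_twist_def)

lemma weyl_mult_add:
  "weyl_mult q (f + g) h = weyl_mult q f h + weyl_mult q g h"
  "weyl_mult q h (f + g) = weyl_mult q h f + weyl_mult q h g"
  by (simp_all add: weyl_mult_def twisted_mult_add_left twisted_mult_add_right)

lemma weyl_twist_add:
  assumes "q \<noteq> 0"
  shows "weyl_twist q (g + g') h = weyl_twist q g h * weyl_twist q g' h"
    and "weyl_twist q g (h + h') = weyl_twist q g h * weyl_twist q g h'"
  using assms
  by (auto simp: weyl_twist_def split_beta power_int_add[symmetric] algebra_simps)

lemma weyl_mult_assoc:
  "q \<noteq> 0 \<Longrightarrow> weyl_mult q (weyl_mult q f g) h = weyl_mult q f (weyl_mult q g h)"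
  unfolding weyl_mult_def by (intro twisted_mult_assoc weyl_twist_add)

lemma weyl_mult_const:
  "weyl_mult q (weyl_const c) f = weyl_mult q f (weyl_const c)"
  by (induction f rule: poly_mapping_linear_induct)
     (auto simp: weyl_mult_add weyl_mult_single zero_prod_def mult.commute)

lemma weyl_mult_one:
  "weyl_mult q (weyl_const 1) f = f" "weyl_mult q f (weyl_const 1) = f"
proof -
  show "weyl_mult q (weyl_const 1) f = f"
    by (induction f rule: poly_mapping_linear_induct)
       (auto simp: weyl_mult_add weyl_mult_single zero_prod_def)
  then show "weyl_mult q f (weyl_const 1) = f" by (simp only: weyl_mult_const[symmetric])
qed

lemma weyl_relations:
  assumes "q \<noteq> 0"
  shows "weyl_mult q (weyl_monom 1 0 0) (weyl_monom 0 1 0)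
           = weyl_mult q (weyl_const (q^2)) (weyl_mult q (weyl_monom 0 1 0) (weyl_monom 1 0 0))"
    and "weyl_mult q (weyl_monom 0 0 1) f = weyl_mult q f (weyl_monom 0 0 1)"
    and "weyl_mult q (weyl_monom i 0 0) (weyl_monom (- i) 0 0) = weyl_const 1"
    and "weyl_mult q (weyl_monom 0 i 0) (weyl_monom 0 (- i) 0) = weyl_const 1"
    and "weyl_mult q (weyl_monom 0 0 i) (weyl_monom 0 0 (- i)) = weyl_const 1"
    and "weyl_monom i j k
           = weyl_mult q (weyl_monom i 0 0) (weyl_mult q (weyl_monom 0 j 0) (weyl_monom 0 0 k))"
proof -
  show "weyl_mult q (weyl_monom 0 0 1) f = weyl_mult q f (weyl_monom 0 0 1)"
    by (induction f rule: poly_mapping_linear_induct)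
       (auto simp: weyl_mult_add weyl_mult_single add.commute)
qed (use assms in \<open>simp_all add: weyl_mult_single zero_prod_def power_int_minus field_simps\<close>)

lemma weyl2_mult_tensor:
  "weyl2_mult q (u \<otimes>\<^sub>W v) (u' \<otimes>\<^sub>W v') = weyl_mult q u u' \<otimes>\<^sub>W weyl_mult q v v'"
proof -
  have sup: "u \<otimes>\<^sub>W v = (\<Sum>g\<in>A. \<Sum>h\<in>B.
        Poly_Mapping.single (g, h) (Poly_Mapping.lookup u g * Poly_Mapping.lookup v h))"
    if "finite A" "finite B" "Poly_Mapping.keys u \<subseteq> A" "Poly_Mapping.keys v \<subseteq> B" for u v A B
    unfolding weyl_tensor_def
    by (rule bilinear_sum_superset
        [where F = "\<lambda>i j a b. Poly_Mapping.single (i, j) (a * b)", OF that]) simp_all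
  have addl: "(u + u') \<otimes>\<^sub>W v = u \<otimes>\<^sub>W v + u' \<otimes>\<^sub>W v" for u u' v
    by (subst (1 2 3) sup[of "Poly_Mapping.keys u \<union> Poly_Mapping.keys u'" "Poly_Mapping.keys v"])
       (use keys_add[of u u'] in
         \<open>auto simp: lookup_add distrib_right single_add sum.distrib\<close>)
  have addr: "v \<otimes>\<^sub>W (u + u') = v \<otimes>\<^sub>W u + v \<otimes>\<^sub>W u'" for u u' v
    by (subst (1 2 3) sup[of "Poly_Mapping.keys v" "Poly_Mapping.keys u \<union> Poly_Mapping.keys u'"])
       (use keys_add[of u u'] in
         \<open>auto simp: lookup_add distrib_left single_add sum.distrib\<close>)
  have sgl: "Poly_Mapping.single g a \<otimes>\<^sub>W Poly_Mapping.single h b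
      = Poly_Mapping.single (g, h) (a * b)" for g h a b
    by (subst sup[of "{g}" "{h}"]) (auto split: if_splits)
  note s = weyl2_mult_def weyl_mult_def addl addr sgl twisted_mult_add_left twisted_mult_add_right
    twisted_mult_single
  show ?thesis
  proof (induction u rule: poly_mapping_linear_induct)
    case (single g a)
    show ?case
    proof (induction v rule: poly_mapping_linear_induct)
      case (single h b)
      show ?case
      proof (induction u' rule: poly_mapping_linear_induct)
        case (single g' a')
        show ?case
          by (induction v' rule: poly_mapping_linear_induct) (simp_all add: s mult_ac)
      qed (simp add: s)
    qed (simp add: s)
  qed (simp add: s)
qed

definition unit_powi :: "'r::monoid_mult \<Rightarrow> 'r \<Rightarrow> int \<Rightarrow> 'r" where
  "unit_powi u u' n = (if 0 \<le> n then u ^ nat n else u' ^ nat (- n))"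

lemma unit_powi_simps [simp]:
  "unit_powi u u' 0 = 1" "unit_powi u u' 1 = u" "unit_powi u u' (- 1) = u'"
  by (simp_all add: unit_powi_def)

lemma unit_powi_Suc:
  assumes "u * u' = 1" "u' * u = 1"
  shows "unit_powi u u' (n + 1) = unit_powi u u' n * u"
proof (cases "0 \<le> n")
  case True
  then show ?thesis by (simp add: unit_powi_def nat_add_distrib power_Suc2 del: power_Suc)
next
  case False
  then obtain m where m: "n = - int (Suc m)" by (metis int_cases2 int_cases not_le negative_zle_0
      of_nat_0_le_iff)
  have "u' ^ Suc m * u = u' ^ m" by (simp add: power_Suc2 mult.assoc assms del: power_Suc)
  then show ?thesis using m by (auto simp: unit_powi_def nat_add_distrib)
qed

lemma unit_powi_pred:
  assumes "u * u' = 1" "u' * u = 1"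
  shows "unit_powi u u' (n - 1) = unit_powi u u' n * u'"
  using unit_powi_Suc[OF assms, of "n - 1"] by (simp add: mult.assoc assms)

lemma unit_powi_add:
  assumes "u * u' = 1" "u' * u = 1"
  shows "unit_powi u u' (m + n) = unit_powi u u' m * unit_powi u u' n"
proof (induction n rule: int_induct[where k = 0])
  case base
  show ?case by simp
next
  case (step1 n)
  then show ?case
    using unit_powi_Suc[OF assms, of "m + n"] unit_powi_Suc[OF assms, of n]
    by (simp add: algebra_simps)
next
  case (step2 n)
  then show ?case
    using unit_powi_pred[OF assms, of "m + n"] unit_powi_pred[OF assms, of n]
    by (simp add: algebra_simps)
qed

lemma unit_powi_commute:
  fixes c :: "complex \<Rightarrow> 'r::ring_1"
  assumes u: "u * u' = 1" "u' * u = 1" and s: "s \<noteq> 0"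
    and c: "c 1 = 1" "\<And>a b. c (a * b) = c a * c b" "\<And>a r. c a * r = r * c a"
    and v: "v * u = c s * (u * v)"
  shows "v * unit_powi u u' n = c (s powi n) * (unit_powi u u' n * v)"
proof (induction n rule: int_induct[where k = 0])
  case base
  show ?case by (simp add: c)
next
  case (step1 n)
  have "v * unit_powi u u' (n + 1) = (v * unit_powi u u' n) * u"
    by (simp add: unit_powi_Suc[OF u] mult.assoc)
  also have "\<dots> = c (s powi n) * (unit_powi u u' n * (v * u))"
    by (simp add: step1 mult.assoc)
  also have "\<dots> = c (s powi n) * (c s * (unit_powi u u' n * u * v))"
    unfolding v by (metis c(3) mult.assoc)
  also have "\<dots> = c (s powi (n + 1)) * (unit_powi u u' (n + 1) * v)"
    using s by (simp add: unit_powi_Suc[OF u] power_int_add c(2) mult.assoc)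
  finally show ?case .
next
  case (step2 n)
  have v': "v * u' = c (inverse s) * (u' * v)"
  proof -
    have "u' * v = u' * (v * u) * u'" by (simp add: mult.assoc u)
    also have "\<dots> = c s * (u' * u * v * u')"
      unfolding v by (metis c(3) mult.assoc)
    also have "\<dots> = c s * (v * u')" by (simp add: u mult.assoc)
    finally have "c (inverse s) * (u' * v) = c (inverse s * s) * (v * u')"
      by (simp add: c(2) mult.assoc)
    then show ?thesis using s by (simp add: c)
  qed
  have "v * unit_powi u u' (n - 1) = (v * unit_powi u u' n) * u'"
    by (simp add: unit_powi_pred[OF u] mult.assoc)
  also have "\<dots> = c (s powi n) * (unit_powi u u' n * (v * u'))"
    by (simp add: step2 mult.assoc)
  also have "\<dots> = c (s powi n) * (c (inverse s) * (unit_powi u u' n * u' * v))"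
    unfolding v' by (metis c(3) mult.assoc)
  also have "\<dots> = c (s powi (n - 1)) * (unit_powi u u' (n - 1) * v)"
    using s by (simp add: unit_powi_pred[OF u] power_int_diff c(2)[symmetric] mult.assoc[symmetric]
      divide_inverse)
  finally show ?case .
qed

lemma weyl_universal:
  fixes c :: "complex \<Rightarrow> 'r::ring_1"
  assumes q: "q \<noteq> 0"
    and c: "c 1 = 1" "\<And>a b. c (a + b) = c a + c b" "\<And>a b. c (a * b) = c a * c b"
      "\<And>a r. c a * r = r * c a"
    and X: "X * X' = 1" "X' * X = 1" and Y: "Y * Y' = 1" "Y' * Y = 1"
    and Z: "Z * Z' = 1" "Z' * Z = 1"
    and rel: "X * Y = c (q^2) * (Y * X)" "Z * X = X * Z" "Z * Y = Y * Z"
  shows "\<exists>!\<phi>. (\<forall>f g. \<phi> (f + g) = \<phi> f + \<phi> g) \<and> (\<forall>f g. \<phi> (weyl_mult q f g) = \<phi> f * \<phi> g) \<and>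
           (\<forall>a. \<phi> (weyl_const a) = c a) \<and>
           \<phi> (weyl_monom 1 0 0) = X \<and> \<phi> (weyl_monom 0 1 0) = Y \<and> \<phi> (weyl_monom 0 0 1) = Z"
    (is "\<exists>!\<phi>. ?P \<phi>")
proof -
  define x y z where "x = unit_powi X X'" and "y = unit_powi Y Y'" and "z = unit_powi Z Z'"
  define M where "M = (\<lambda>(i, j, k). x i * (y j * z k))"
  define \<phi> where
    "\<phi> f = (\<Sum>g\<in>Poly_Mapping.keys f. c (Poly_Mapping.lookup f g) * M g)" for f :: weyl
  have c0: "c 0 = 0" using c(2)[of 0 0] by simp
  have add_x: "x (i + j) = x i * x j" for i j
    unfolding x_def by (rule unit_powi_add[OF X])
  have add_y: "y (i + j) = y i * y j" for i j
    unfolding y_def by (rule unit_powi_add[OF Y])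
  have add_z: "z (i + j) = z i * z j" for i j
    unfolding z_def by (rule unit_powi_add[OF Z])
  have Yx: "x i * Y = c (q powi (2 * i)) * (Y * x i)" for i
  proof -
    have "c (inverse (q^2)) * (X * Y) = c (inverse (q^2) * q^2) * (Y * X)"
      by (simp only: rel(1) c(3) mult.assoc)
    then have "Y * X = c (inverse (q^2)) * (X * Y)" using q by (simp add: c(1))
    then have "Y * x i = c (inverse (q^2) powi i) * (x i * Y)"
      unfolding x_def by (rule unit_powi_commute[OF X _ c(1,3,4), rotated]) (use q in simp)
    then have "c ((q^2) powi i) * (Y * x i)
        = c ((q^2) powi i * inverse (q^2) powi i) * (x i * Y)"
      by (simp only: c(3) mult.assoc)
    then show ?thesis using q
      by (simp add: c(1) power_int_mult_distrib[symmetric] power_int_mult)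
  qed
  have xy: "x i * y j = c (q powi (2 * i * j)) * (y j * x i)" for i j
  proof -
    have "x i * y j = c ((q powi (2 * i)) powi j) * (y j * x i)"
      unfolding y_def by (rule unit_powi_commute[OF Y _ c(1,3,4) Yx]) (use q in simp)
    then show ?thesis by (simp add: power_int_mult)
  qed
  have yx: "y j * x i = c (q powi (- 2 * j * i)) * (x i * y j)" for i j
  proof -
    have "c (q powi (- 2 * j * i)) * (x i * y j)
        = c (q powi (- 2 * j * i) * q powi (2 * i * j)) * (y j * x i)"
      by (simp only: xy c(3) mult.assoc)
    also have "\<dots> = y j * x i" using q by (simp add: power_int_add[symmetric] c(1) mult.commute)
    finally show ?thesis by simp
  qed
  have zc: "z k * r = r * z k" if "Z * r = r * Z" for k r
  proof -
    have "r * Z = c 1 * (Z * r)" using that by (simp add: c(1))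
    from unit_powi_commute[OF Z _ c(1,3,4) this, of k] show ?thesis
      by (simp add: z_def c(1))
  qed
  have xz: "z k * x i = x i * z k" for i k
  proof (rule zc)
    have "Z * X = c 1 * (X * Z)" by (simp add: c(1) rel)
    from unit_powi_commute[OF X _ c(1,3,4) this, of i] show "Z * x i = x i * Z"
      by (simp add: x_def c(1))
  qed
  have yz: "z k * y i = y i * z k" for i k
  proof (rule zc)
    have "Z * Y = c 1 * (Y * Z)" by (simp add: c(1) rel)
    from unit_powi_commute[OF Y _ c(1,3,4) this, of i] show "Z * y i = y i * Z"
      by (simp add: y_def c(1))
  qed
  have M_mult: "c (weyl_twist q g h) * M (g + h) = M g * M h" for g h
  proof -
    obtain i j k i' j' k' where gh: "g = (i, j, k)" "h = (i', j', k')"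
      by (cases g, cases h) blast
    have l: "y j * (x i' * r) = c (q powi (- 2 * j * i')) * (x i' * (y j * r))"
      "z k * (x i' * r) = x i' * (z k * r)" "z k * (y j' * r) = y j' * (z k * r)"
      "x i * (c a * r) = c a * (x i * r)" for r a
    proof -
      show "y j * (x i' * r) = c (q powi (- 2 * j * i')) * (x i' * (y j * r))"
        using arg_cong[OF yx[of j i'], of "\<lambda>t. t * r"] by (simp only: mult.assoc)
      show "z k * (x i' * r) = x i' * (z k * r)"
        using arg_cong[OF xz[of k i'], of "\<lambda>t. t * r"] by (simp only: mult.assoc)
      show "z k * (y j' * r) = y j' * (z k * r)"
        using arg_cong[OF yz[of k j'], of "\<lambda>t. t * r"] by (simp only: mult.assoc)
      show "x i * (c a * r) = c a * (x i * r)"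
        using arg_cong[OF c(4)[of a "x i"], of "\<lambda>t. t * r"] by (simp only: mult.assoc)
    qed
    show ?thesis
      unfolding gh M_def weyl_twist_def add_Pair prod.case add_x add_y add_z
      by (simp only: mult.assoc l)
  qed
  have \<phi>_sup: "\<phi> f = (\<Sum>g\<in>A. c (Poly_Mapping.lookup f g) * M g)"
    if "finite A" "Poly_Mapping.keys f \<subseteq> A" for f A
    unfolding \<phi>_def using that by (intro sum.mono_neutral_left) (auto simp: in_keys_iff c0)
  have \<phi>_add: "\<phi> (f + g) = \<phi> f + \<phi> g" for f g
    by (subst (1 2 3) \<phi>_sup[of "Poly_Mapping.keys f \<union> Poly_Mapping.keys g"])
       (use keys_add[of f g] in \<open>auto simp: lookup_add c(2) distrib_right sum.distrib\<close>)
  have \<phi>_single: "\<phi> (Poly_Mapping.single g a) = c a * M g" for g a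
    by (subst \<phi>_sup[of "{g}"]) (auto split: if_splits)
  have \<phi>_mult: "\<phi> (weyl_mult q f g) = \<phi> f * \<phi> g" for f g
  proof (induction f rule: poly_mapping_linear_induct)
    case (single i a)
    show ?case
    proof (induction g rule: poly_mapping_linear_induct)
      case (single j b)
      have "\<phi> (weyl_mult q (Poly_Mapping.single i a) (Poly_Mapping.single j b))
          = c (a * b) * (c (weyl_twist q i j) * M (i + j))"
      proof -
        have "weyl_twist q i j * a * b = (a * b) * weyl_twist q i j" by simp
        then show ?thesis
          unfolding weyl_mult_def twisted_mult_single \<phi>_single
          by (simp only: c(3)[of "a * b"] mult.assoc[of "c (a * b)"])
      qed
      also have "\<dots> = c a * (M i * (c b * M j))"
        unfolding M_mult c(3)
        using arg_cong[OF c(4)[of b "M i"], of "\<lambda>t. c a * (t * M j)"]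
        by (simp only: mult.assoc)
      finally show ?case by (simp add: \<phi>_single mult.assoc)
    qed (simp add: weyl_mult_add \<phi>_add distrib_left)
  qed (simp add: weyl_mult_add \<phi>_add distrib_right)
  have "?P \<phi>"
    by (auto simp: \<phi>_add \<phi>_mult \<phi>_single M_def zero_prod_def x_def y_def z_def c(1))
  moreover have "\<psi> = \<phi>" if \<psi>: "?P \<psi>" for \<psi>
  proof
    fix f
    have eq: "\<psi> (weyl_monom i 0 0) = x i \<and> \<psi> (weyl_monom 0 i 0) = y i \<and>
        \<psi> (weyl_monom 0 0 i) = z i" for i
    proof (induction i rule: int_induct[where k = 0])
      case base
      from \<psi> have "\<psi> (weyl_const 1) = c 1" by blast
      then show ?case using c(1) by (simp add: x_def y_def z_def flip: zero_prod_def)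
    next
      case (step1 i)
      have "\<psi> (weyl_monom (i + 1) 0 0) = \<psi> (weyl_mult q (weyl_monom i 0 0) (weyl_monom 1 0 0))"
        "\<psi> (weyl_monom 0 (i + 1) 0) = \<psi> (weyl_mult q (weyl_monom 0 i 0) (weyl_monom 0 1 0))"
        "\<psi> (weyl_monom 0 0 (i + 1)) = \<psi> (weyl_mult q (weyl_monom 0 0 i) (weyl_monom 0 0 1))"
        by (simp_all add: weyl_mult_single)
      then show ?case using \<psi> step1
        by (simp add: x_def y_def z_def unit_powi_Suc X Y Z)
    next
      case (step2 i)
      have "\<psi> (weyl_monom i 0 0) = \<psi> (weyl_mult q (weyl_monom (i - 1) 0 0) (weyl_monom 1 0 0))"
        "\<psi> (weyl_monom 0 i 0) = \<psi> (weyl_mult q (weyl_monom 0 (i - 1) 0) (weyl_monom 0 1 0))"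
        "\<psi> (weyl_monom 0 0 i) = \<psi> (weyl_mult q (weyl_monom 0 0 (i - 1)) (weyl_monom 0 0 1))"
        by (simp_all add: weyl_mult_single)
      then have "x i = \<psi> (weyl_monom (i - 1) 0 0) * X" "y i = \<psi> (weyl_monom 0 (i - 1) 0) * Y"
        "z i = \<psi> (weyl_monom 0 0 (i - 1)) * Z"
        using \<psi> step2 by auto
      then show ?case
        by (simp add: x_def y_def z_def unit_powi_pred X Y Z mult.assoc)
    qed
    have "\<psi> (Poly_Mapping.single g a) = c a * M g" for g a
    proof (cases g)
      case (fields i j k)
      have "Poly_Mapping.single g a = weyl_mult q (weyl_const a) (weyl_monom i j k)"
        by (simp add: fields weyl_mult_single zero_prod_def)
      also have "weyl_monom i j k
          = weyl_mult q (weyl_monom i 0 0) (weyl_mult q (weyl_monom 0 j 0) (weyl_monom 0 0 k))"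
        by (rule weyl_relations(6)[OF q])
      finally show ?thesis using \<psi> eq by (simp add: M_def fields)
    qed
    then show "\<psi> f = \<phi> f"
      by (induction f rule: poly_mapping_linear_induct) (use \<psi> \<phi>_add \<phi>_single in auto)
  qed
  ultimately show ?thesis by blast
qed


section \<open>Central subalgebras and characters at the root of unity\<close>

definition xi_root :: "nat \<Rightarrow> complex" where
  "xi_root N = exp (pi * \<i> / N)"

inductive_set weyl_Z0 :: "nat \<Rightarrow> weyl set" for N :: nat where
  const: "weyl_const c \<in> weyl_Z0 N"
| x: "weyl_monom (int N) 0 0 \<in> weyl_Z0 N"
| x_inv: "weyl_monom (- int N) 0 0 \<in> weyl_Z0 N"
| y: "weyl_monom 0 (int N) 0 \<in> weyl_Z0 N"
| y_inv: "weyl_monom 0 (- int N) 0 \<in> weyl_Z0 N"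
| z: "weyl_monom 0 0 (int N) \<in> weyl_Z0 N"
| z_inv: "weyl_monom 0 0 (- int N) \<in> weyl_Z0 N"
| add: "u \<in> weyl_Z0 N \<Longrightarrow> v \<in> weyl_Z0 N \<Longrightarrow> u + v \<in> weyl_Z0 N"
| mult: "u \<in> weyl_Z0 N \<Longrightarrow> v \<in> weyl_Z0 N \<Longrightarrow> weyl_mult (xi_root N) u v \<in> weyl_Z0 N"

inductive_set weyl2_Z0 :: "nat \<Rightarrow> weyl2 set" for N :: nat where
  tensor: "u \<in> weyl_Z0 N \<Longrightarrow> v \<in> weyl_Z0 N \<Longrightarrow> u \<otimes>\<^sub>W v \<in> weyl2_Z0 N"
| add: "u \<in> weyl2_Z0 N \<Longrightarrow> v \<in> weyl2_Z0 N \<Longrightarrow> u + v \<in> weyl2_Z0 N"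

text \<open>Only the values of a character on \<open>weyl_Z0 N\<close> are meaningful.\<close>

definition is_character :: "nat \<Rightarrow> (weyl \<Rightarrow> complex) \<Rightarrow> bool" where
  "is_character N \<chi> \<longleftrightarrow>
     (\<forall>c. \<chi> (weyl_const c) = c) \<and>
     (\<forall>u\<in>weyl_Z0 N. \<forall>v\<in>weyl_Z0 N.
        \<chi> (u + v) = \<chi> u + \<chi> v \<and> \<chi> (weyl_mult (xi_root N) u v) = \<chi> u * \<chi> v)"

definition character_coords :: "nat \<Rightarrow> (weyl \<Rightarrow> complex) \<Rightarrow> complex \<times> complex \<times> complex" where
  "character_coords N \<chi> =
     (\<chi> (weyl_monom (int N) 0 0), \<chi> (weyl_monom 0 (int N) 0), \<chi> (weyl_monom 0 0 (int N)))"

text \<open>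
  The linear functional with $u \otimes v \mapsto \chi_1(u)\,\chi_2(v)$, written out on basis vectors:
  the monomials occurring in an element of \<open>weyl2_Z0 N\<close> are of the form \<open>e\<^sub>g \<otimes> e\<^sub>h\<close> with \<open>e\<^sub>g\<close> and
  \<open>e\<^sub>h\<close> in \<open>weyl_Z0 N\<close>.
\<close>

definition character_tensor :: "(weyl \<Rightarrow> complex) \<Rightarrow> (weyl \<Rightarrow> complex) \<Rightarrow> weyl2 \<Rightarrow> complex" where
  "character_tensor \<chi>1 \<chi>2 w =
     (\<Sum>(g, h)\<in>Poly_Mapping.keys w. Poly_Mapping.lookup w (g, h) *
        \<chi>1 (Poly_Mapping.single g 1) * \<chi>2 (Poly_Mapping.single h 1))"


section \<open>The skew field of fractions and the map R\<close>

definition is_weyl2_hom :: "complex \<Rightarrow> (weyl2 \<Rightarrow> 'd::ring_1) \<Rightarrow> bool" where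
  "is_weyl2_hom q \<phi> \<longleftrightarrow>
     \<phi> (weyl2_const 1) = 1 \<and> (\<forall>u v. \<phi> (u + v) = \<phi> u + \<phi> v) \<and>
     (\<forall>u v. \<phi> (weyl2_mult q u v) = \<phi> u * \<phi> v)"

text \<open>
  The division ring \<open>'d\<close>, with the embedding \<open>\<iota>\<close>, is the skew field of (Ore) fractions of the tensor
  square.  In a \<open>division_ring\<close>, \<open>a / b\<close> is \<open>a * inverse b\<close>.
\<close>

definition is_weyl2_fractions :: "complex \<Rightarrow> (weyl2 \<Rightarrow> 'd::division_ring) \<Rightarrow> bool" where
  "is_weyl2_fractions q \<iota> \<longleftrightarrow>
     is_weyl2_hom q \<iota> \<and> inj \<iota> \<and> (\<forall>d. \<exists>u v. v \<noteq> 0 \<and> d = \<iota> u / \<iota> v)"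

text \<open>
  The complex scalars of \<open>'d\<close> are the elements \<open>\<iota> (weyl2_const c)\<close>, so the second conjunct is
  complex linearity.
\<close>

definition is_RW :: "complex \<Rightarrow> (weyl2 \<Rightarrow> 'd::division_ring) \<Rightarrow> (weyl2 \<Rightarrow> 'd) \<Rightarrow> bool" where
  "is_RW q \<iota> R \<longleftrightarrow>
     is_weyl2_hom q R \<and> (\<forall>c. R (weyl2_const c) = \<iota> (weyl2_const c)) \<and>
     (let X1 = weyl_monom 1 0 0 \<otimes>\<^sub>W weyl_const 1; X2 = weyl_const 1 \<otimes>\<^sub>W weyl_monom 1 0 0;
          Y1inv = weyl_monom 0 (- 1) 0 \<otimes>\<^sub>W weyl_const 1;
          Y1 = weyl_monom 0 1 0 \<otimes>\<^sub>W weyl_const 1; Y2 = weyl_const 1 \<otimes>\<^sub>W weyl_monom 0 1 0;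
          Z1 = weyl_monom 0 0 1 \<otimes>\<^sub>W weyl_const 1; Z2 = weyl_const 1 \<otimes>\<^sub>W weyl_monom 0 0 1;
          x1 = \<iota> X1; x2 = \<iota> X2; y1 = \<iota> Y1; y2 = \<iota> Y2; z1 = \<iota> Z1; z2 = \<iota> Z2;
          g = 1 - inverse x1 * y1 * (z1 - x1) * inverse y2 * (x2 - inverse z2)
      in R X1 = x1 * g \<and>
         R X2 = inverse g * x2 \<and>
         R Z1 = z1 \<and>
         R Z2 = z2 \<and>
         R Y1inv = inverse y2 + (inverse y1 - inverse z2 * inverse y2) * inverse x2 \<and>
         R Y2 = z1 / z2 * y1 + (y2 - inverse z2 * y1) * x1)"

definition Z0_fractions :: "nat \<Rightarrow> (weyl2 \<Rightarrow> 'd::division_ring) \<Rightarrow> 'd set" where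
  "Z0_fractions N \<iota> = {\<iota> u / \<iota> v | u v. u \<in> weyl2_Z0 N \<and> v \<in> weyl2_Z0 N \<and> v \<noteq> 0}"

text \<open>The extension of \<open>R\<close> from \<open>weyl2_Z0 N\<close> to its fraction field, $u/v \mapsto R(u)/R(v)$.\<close>

definition RW_on_fractions ::
  "nat \<Rightarrow> (weyl2 \<Rightarrow> 'd::division_ring) \<Rightarrow> (weyl2 \<Rightarrow> 'd) \<Rightarrow> 'd \<Rightarrow> 'd" where
  "RW_on_fractions N \<iota> R w =
     (THE r. \<exists>u\<in>weyl2_Z0 N. \<exists>v\<in>weyl2_Z0 N. v \<noteq> 0 \<and> w = \<iota> u / \<iota> v \<and> r = R u / R v)"

definition RW_inverse ::
  "nat \<Rightarrow> (weyl2 \<Rightarrow> 'd::division_ring) \<Rightarrow> (weyl2 \<Rightarrow> 'd) \<Rightarrow> 'd \<Rightarrow> 'd" where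
  "RW_inverse N \<iota> R = inv_into (Z0_fractions N \<iota>) (RW_on_fractions N \<iota> R)"

text \<open>The rational function \<open>w\<close> is regular at the point \<open>\<psi>\<close> and takes the value \<open>r\<close> there.\<close>

definition has_value_at ::
  "nat \<Rightarrow> (weyl2 \<Rightarrow> 'd::division_ring) \<Rightarrow> 'd \<Rightarrow> (weyl2 \<Rightarrow> complex) \<Rightarrow> complex \<Rightarrow> bool" where
  "has_value_at N \<iota> w \<psi> r \<longleftrightarrow>
     (\<exists>u\<in>weyl2_Z0 N. \<exists>v\<in>weyl2_Z0 N. \<psi> v \<noteq> 0 \<and> w = \<iota> u / \<iota> v \<and> r = \<psi> u / \<psi> v)"


section \<open>The braiding\<close>

definition braiding_A ::
  "complex \<times> complex \<times> complex \<Rightarrow> complex \<times> complex \<times> complex \<Rightarrow> complex" where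
  "braiding_A = (\<lambda>(a1, b1, m1) (a2, b2, m2).
     1 - m1 * b1 / b2 * (1 - a1 / m1) * (1 - 1 / (m2 * a2)))"

text \<open>The result is the pair $(\chi_{2'}, \chi_{1'})$, in this order.\<close>

definition braiding ::
  "complex \<times> complex \<times> complex \<Rightarrow> complex \<times> complex \<times> complex \<Rightarrow>
   (complex \<times> complex \<times> complex) \<times> (complex \<times> complex \<times> complex)" where
  "braiding = (\<lambda>(a1, b1, m1) (a2, b2, m2).
     let A = braiding_A (a1, b1, m1) (a2, b2, m2);
         a1' = a1 * inverse A;
         a2' = a2 * A;
         b1' = m2 * b2 / m1 * inverse (1 - m2 * a2 * (1 - b2 / (m1 * b1)));
         b2' = b1 * (1 - m1 / a1 * (1 - b2 / (m1 * b1)))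
     in ((a2', b2', m2), (a1', b1', m1)))"

text \<open>All denominators that are not already products of coordinates are nonzero.\<close>

definition braiding_defined ::
  "complex \<times> complex \<times> complex \<Rightarrow> complex \<times> complex \<times> complex \<Rightarrow> bool" where
  "braiding_defined = (\<lambda>(a1, b1, m1) (a2, b2, m2).
     braiding_A (a1, b1, m1) (a2, b2, m2) \<noteq> 0 \<and>
     1 - m2 * a2 * (1 - b2 / (m1 * b1)) \<noteq> 0)"

end

theory Submission
  imports Defs
begin

text \<open>
  The formulas for $\mathcal R^{\mathcal W}$ express the generators through sums of terms that
  $q^2$-commute.  As $\xi^2$ is a primitive $N$-th root of unity, the $q$-binomial theorem collapses to
  $(U + V)^N = U^N + V^N$ for such terms, so the values of $R$ on $N$-th powers are explicit and lie
  in the fraction field of the central subalgebra.  They define a rational map of the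
  torus of characters (the pullback), and the braiding formulas are its inverse.  Rational
  identities in the fraction field are checked by evaluation at generic characters, where they become
  identities between complex numbers.  Since almost every character lies in the image of the pullback,
  $R$ is injective on the central subalgebra, which makes $R$ on fractions and its inverse meaningful.
\<close>

section \<open>The $q$-binomial theorem at a root of unity\<close>

text \<open>Two devices replace it: on the central subalgebra the twist is trivial, so the twisted
  product agrees with the commutative product \<open>*\<close> of the type; and points evaluate
  fractions to complex numbers. The formulas give sums for the images of x_1, x_2^{-1}, y_1^{-1},
  y_2, whereas the images of the opposite powers are inverses of such sums; hence the asymmetric
  choice of the generators whose images are computed. Reordering an N-th power such as (x y)^N
  yields the sign (-1)^{N-1}, which cancels against the (-1)^N of the negative terms, so the final
  formulas carry no sign depending on N. Only the homomorphism property of \<open>R\<close> is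
  given, and a quotient \<open>R u / R v\<close> is well behaved only if \<open>R v\<close> is
  nonzero; this is why injectivity has to be extracted from the braiding formulas. The inverse of
  \<open>R\<close> is handled without division, through equations
  \<open>R P = \<iota> u * R Q\<close>, which say that it sends u to P / Q.\<close>

lemma power_mult_distrib_commuting:
  fixes a b :: "'a::monoid_mult"
  assumes "a * b = b * a"
  shows "(a * b) ^ n = a ^ n * b ^ n"
proof (induction n)
  case (Suc n)
  have "(a * b) ^ Suc n = a * (b * a ^ n) * b ^ n"
    by (simp add: Suc mult.assoc)
  also have "b * a ^ n = a ^ n * b"
    using power_commuting_commutes[OF assms] by simp
  finally show ?case by (simp add: mult.assoc)
qed simp

text \<open>Gaussian binomial coefficients by a Pascal recursion. The recursion involves no
  division, so it makes sense at roots of unity, where the quotient formula may read 0/0.\<close>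

fun gauss_binomial :: "complex \<Rightarrow> nat \<Rightarrow> nat \<Rightarrow> complex" where
  "gauss_binomial s n 0 = 1"
| "gauss_binomial s 0 (Suc k) = 0"
| "gauss_binomial s (Suc n) (Suc k) = s ^ Suc k * gauss_binomial s n (Suc k) + gauss_binomial s n k"

lemma gauss_binomial_eq_0: "n < k \<Longrightarrow> gauss_binomial s n k = 0"
  by (induction s n k rule: gauss_binomial.induct) auto

lemma gauss_binomial_self [simp]: "gauss_binomial s n n = 1"
  by (induction n) (auto simp: gauss_binomial_eq_0)

text \<open>The quotient formula with its denominator multiplied out; in this form it holds for
  every s and can be specialized to a root of unity.\<close>

lemma gauss_binomial_prod:
  "gauss_binomial s n k * (\<Prod>i<k. 1 - s ^ Suc i) = (\<Prod>i<k. 1 - s ^ (n - i))"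
proof (induction n arbitrary: k)
  case 0
  show ?case by (cases k) auto
next
  case (Suc n)
  show ?case
  proof (cases k)
    case (Suc l)
    let ?P = "\<lambda>k. \<Prod>i<k. 1 - s ^ Suc i" and ?F = "\<lambda>k. \<Prod>i<k. 1 - s ^ (n - i)"
    have "gauss_binomial s (Suc n) (Suc l) * ?P (Suc l)
        = s ^ Suc l * (gauss_binomial s n (Suc l) * ?P (Suc l))
          + (gauss_binomial s n l * ?P l) * (1 - s ^ Suc l)"
      by (simp add: algebra_simps)
    also have "\<dots> = ?F l * (s ^ Suc l * (1 - s ^ (n - l)) + (1 - s ^ Suc l))"
      unfolding Suc.IH by (simp add: algebra_simps)
    also have "\<dots> = ?F l * (1 - s ^ Suc n)"
    proof (cases "l \<le> n")
      case True
      then have "s ^ Suc l * s ^ (n - l) = s ^ Suc n"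
        by (simp flip: power_add del: power_Suc)
      then show ?thesis by (simp add: right_diff_distrib del: power_Suc)
    next
      case False
      \<comment> \<open>For l > n the product contains the index i = n, whose factor is 1 - s^0 =
        0.\<close>
      then have "?F l = 0" by (subst prod_zero_iff) (auto intro!: bexI[of _ n])
      then show ?thesis by simp
    qed
    also have "\<dots> = (\<Prod>i<Suc l. 1 - s ^ (Suc n - i))"
      by (simp add: prod.lessThan_Suc_shift mult.commute del: prod.lessThan_Suc)
    finally show ?thesis by (simp only: Suc)
  qed simp
qed

text \<open>In the product formula the factor 1 - s^n on the right vanishes, while the factors on
  the left involve only exponents from 1 to k < n and are nonzero.\<close>

lemma gauss_binomial_root_of_unity:
  assumes "s ^ n = 1" "\<And>i. 0 < i \<Longrightarrow> i < n \<Longrightarrow> s ^ i \<noteq> 1" "0 < k" "k < n"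
  shows "gauss_binomial s n k = 0"
proof -
  have "(\<Prod>i<k. 1 - s ^ (n - i)) = 0"
    using assms by (subst prod_zero_iff) (auto intro!: bexI[of _ 0])
  moreover have "(\<Prod>i<k. 1 - s ^ Suc i) \<noteq> 0"
    using assms(2)[of "Suc _"] assms(4) by (subst prod_zero_iff) (auto simp del: power_Suc)
  ultimately show ?thesis using gauss_binomial_prod[of s n k] by (metis mult_eq_0_iff)
qed

text \<open>Multiplying by U + V on the left and moving U past V^k produces s^k, which is the Pascal
  recursion. The map \<open>c\<close> embeds the scalars centrally, since the ring carries no
  declared complex algebra structure.\<close>

lemma q_binomial_theorem:
  fixes U V :: "'r::ring_1" and c :: "complex \<Rightarrow> 'r"
  assumes c: "c 0 = 0" "c 1 = 1" "\<And>a b. c (a + b) = c a + c b" "\<And>a b. c (a * b) = c a * c b"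
      "\<And>a r. c a * r = r * c a"
    and UV: "U * V = c s * (V * U)"
  shows "(U + V) ^ n = (\<Sum>k\<le>n. c (gauss_binomial s n k) * (V ^ k * U ^ (n - k)))"
proof (induction n)
  case 0
  show ?case by (simp add: c)
next
  case (Suc n)
  let ?g = "gauss_binomial s"
  have cl: "r * (c a * x) = c a * (r * x)" for r a x
    by (simp only: mult.assoc[symmetric] c(5)[of a r])
  have UVk: "U * V ^ k = c (s ^ k) * (V ^ k * U)" for k
  proof (induction k)
    case (Suc k)
    have "U * V ^ Suc k = (U * V ^ k) * V" by (simp only: power_Suc2 mult.assoc)
    also have "\<dots> = c (s ^ k) * (V ^ k * (U * V))" by (simp only: Suc mult.assoc)
    also have "\<dots> = c (s ^ k) * (V ^ k * c s * (V * U))" by (simp only: UV mult.assoc)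
    also have "V ^ k * c s = c s * V ^ k" by (rule c(5)[symmetric])
    also have "c (s ^ k) * (c s * V ^ k * (V * U)) = c (s ^ Suc k) * (V ^ Suc k * U)"
      by (simp add: power_Suc2 c(4) mult.assoc del: power_Suc)
    finally show ?case .
  qed (simp add: c(1,2))
  have *: "(U + V) * (c a * (V ^ k * U ^ (n - k)))
      = c (a * s ^ k) * (V ^ k * U ^ (Suc n - k)) + c a * (V ^ Suc k * U ^ (n - k))"
    if "k \<le> n" for a k
  proof -
    have "U * (c a * (V ^ k * U ^ (n - k))) = c a * ((U * V ^ k) * U ^ (n - k))"
      by (simp only: cl mult.assoc)
    also have "\<dots> = c (a * s ^ k) * (V ^ k * U ^ (Suc n - k))"
      using that by (simp add: UVk c(4) Suc_diff_le mult.assoc del: power_Suc)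
        (simp add: power_Suc)
    finally have 1: "U * (c a * (V ^ k * U ^ (n - k))) = c (a * s ^ k) * (V ^ k * U ^ (Suc n - k))" .
    have 2: "V * (c a * (V ^ k * U ^ (n - k))) = c a * (V ^ Suc k * U ^ (n - k))"
      by (simp only: cl mult.assoc power_Suc)
    show ?thesis by (simp only: distrib_right 1 2)
  qed
  have "(U + V) ^ Suc n = (\<Sum>k\<le>n. (U + V) * (c (?g n k) * (V ^ k * U ^ (n - k))))"
    by (simp add: Suc sum_distrib_left)
  also have "\<dots> = (\<Sum>k\<le>n. c (?g n k * s ^ k) * (V ^ k * U ^ (Suc n - k)))
      + (\<Sum>k\<le>n. c (?g n k) * (V ^ Suc k * U ^ (n - k)))"
    by (simp only: sum.distrib[symmetric]) (intro sum.cong refl *, simp)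
  also have "(\<Sum>k\<le>n. c (?g n k * s ^ k) * (V ^ k * U ^ (Suc n - k)))
      = (\<Sum>k\<le>Suc n. c (?g n k * s ^ k) * (V ^ k * U ^ (Suc n - k)))"
    by (simp add: gauss_binomial_eq_0 c(1))
  also have "\<dots> = U ^ Suc n
      + (\<Sum>k\<le>n. c (?g n (Suc k) * s ^ Suc k) * (V ^ Suc k * U ^ (n - k)))"
    by (subst sum.atMost_Suc_shift) (simp add: c(1,2))
  also have "U ^ Suc n + (\<Sum>k\<le>n. c (?g n (Suc k) * s ^ Suc k) * (V ^ Suc k * U ^ (n - k)))
        + (\<Sum>k\<le>n. c (?g n k) * (V ^ Suc k * U ^ (n - k)))
      = U ^ Suc n + (\<Sum>k\<le>n. c (?g (Suc n) (Suc k)) * (V ^ Suc k * U ^ (n - k)))"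
    unfolding add.assoc sum.distrib[symmetric]
    by (intro arg_cong2[of _ _ _ _ "(+)"] sum.cong refl)
       (simp only: gauss_binomial.simps c(3) distrib_right mult.commute[of "s ^ Suc _"])
  also have "\<dots> = (\<Sum>k\<le>Suc n. c (?g (Suc n) k) * (V ^ k * U ^ (Suc n - k)))"
    by (subst sum.atMost_Suc_shift) (simp add: c(1,2))
  finally show ?case .
qed

lemma power_add_q_commuting:
  fixes U V :: "'r::ring_1" and c :: "complex \<Rightarrow> 'r"
  assumes c: "c 0 = 0" "c 1 = 1" "\<And>a b. c (a + b) = c a + c b" "\<And>a b. c (a * b) = c a * c b"
      "\<And>a r. c a * r = r * c a"
    and UV: "U * V = c s * (V * U)"
    and s: "s ^ n = 1" "\<And>i. 0 < i \<Longrightarrow> i < n \<Longrightarrow> s ^ i \<noteq> 1" and n: "0 < n"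
  shows "(U + V) ^ n = U ^ n + V ^ n"
proof -
  have "(U + V) ^ n = (\<Sum>k\<le>n. c (gauss_binomial s n k) * (V ^ k * U ^ (n - k)))"
    by (rule q_binomial_theorem[OF c UV])
  also have "\<dots> = (\<Sum>k\<in>{0, n}. c (gauss_binomial s n k) * (V ^ k * U ^ (n - k)))"
    using gauss_binomial_root_of_unity[OF s] n
    by (intro sum.mono_neutral_right) (auto simp: c(1))
  also have "\<dots> = U ^ n + V ^ n" using n by (simp add: c(2))
  finally show ?thesis .
qed

section \<open>Characters of the central subalgebra\<close>

lemma complex_nth_root_exists:
  assumes "0 < n"
  obtains t :: complex where "t ^ n = c"
proof (cases "c = 0")
  case True
  then show ?thesis using that[of 0] assms by simp
next
  case False
  then have "card {z. z ^ n = c} = n" using assms by (rule card_nth_roots)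
  then have "{z. z ^ n = c} \<noteq> {}" using assms by (metis card.empty less_irrefl)
  then show ?thesis using that by blast
qed

text \<open>Dedekind's independence of characters, with the exponents g indexing characters of the
  multiplicatively closed set T. It shows that a Laurent polynomial vanishing on the torus is
  zero.\<close>

lemma dedekind_independence:
  fixes M :: "'t \<Rightarrow> 'g \<Rightarrow> complex" and mul :: "'t \<Rightarrow> 't \<Rightarrow> 't"
  assumes mul: "\<And>s t g. s \<in> T \<Longrightarrow> t \<in> T \<Longrightarrow> M (mul s t) g = M s g * M t g"
    and closed: "\<And>s t. s \<in> T \<Longrightarrow> t \<in> T \<Longrightarrow> mul s t \<in> T"
    and nz: "\<And>t g. t \<in> T \<Longrightarrow> M t g \<noteq> 0" and ne: "T \<noteq> {}"
    and sep: "\<And>g h. g \<noteq> h \<Longrightarrow> \<exists>t\<in>T. M t g \<noteq> M t h"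
    and "finite S" "\<And>t. t \<in> T \<Longrightarrow> (\<Sum>g\<in>S. c g * M t g) = 0" "g \<in> S"
  shows "c g = 0"
  using assms(6-)
proof (induction S arbitrary: c g rule: finite_induct)
  case (insert h S)
  have S: "c g = 0" if "g \<in> S" for g
  proof -
    have "g \<noteq> h" using insert.hyps(2) that by blast
    then obtain s where s: "s \<in> T" "M s g \<noteq> M s h"
      using sep by blast
    \<comment> \<open>The relation at \<open>mul s t\<close> minus \<open>M s h\<close> times the
      relation at t has coefficient 0 at h, so a shorter relation remains.\<close>
    have "(\<Sum>g\<in>S. (c g * (M s g - M s h)) * M t g) = 0" if t: "t \<in> T" for t
    proof -
      have "(\<Sum>g\<in>S. (c g * (M s g - M s h)) * M t g)
          = (\<Sum>g\<in>insert h S. (c g * (M s g - M s h)) * M t g)"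
        using insert.hyps by simp
      also have "\<dots> = (\<Sum>g\<in>insert h S. c g * M (mul s t) g)
          - M s h * (\<Sum>g\<in>insert h S. c g * M t g)"
        unfolding sum_distrib_left sum_subtractf[symmetric]
        by (intro sum.cong refl) (simp add: mul s t algebra_simps)
      also have "\<dots> = 0" using insert.prems(1) closed s t by simp
      finally show ?thesis .
    qed
    from insert.IH[OF this that] s show ?thesis by simp
  qed
  moreover have "c h = 0"
  proof -
    obtain t where t: "t \<in> T" using ne by blast
    have "(\<Sum>g\<in>S. c g * M t g) = 0" by (intro sum.neutral ballI) (simp add: S)
    then show ?thesis using insert.prems(1)[OF t] insert.hyps nz[OF t] by simp
  qed
  ultimately show ?case using insert.prems(2) by blast
qed simp

section \<open>The exponent lattice and the commutative ring structure on the central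
  subalgebra\<close>

definition weyl2_twist :: "complex \<Rightarrow> weyl_exp \<times> weyl_exp \<Rightarrow> weyl_exp \<times> weyl_exp \<Rightarrow> complex" where
  "weyl2_twist q = (\<lambda>(g1, g2) (h1, h2). weyl_twist q g1 h1 * weyl_twist q g2 h2)"

lemma weyl2_mult_eq: "weyl2_mult q = twisted_mult (weyl2_twist q)"
  by (simp add: weyl2_mult_def weyl2_twist_def)

lemma weyl_tensor_superset:
  assumes "finite A" "finite B" "Poly_Mapping.keys u \<subseteq> A" "Poly_Mapping.keys v \<subseteq> B"
  shows "u \<otimes>\<^sub>W v = (\<Sum>g\<in>A. \<Sum>h\<in>B.
           Poly_Mapping.single (g, h) (Poly_Mapping.lookup u g * Poly_Mapping.lookup v h))"
  unfolding weyl_tensor_def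
  by (rule bilinear_sum_superset
        [where F = "\<lambda>i j a b. Poly_Mapping.single (i, j) (a * b)", OF assms]) simp_all

lemma weyl_tensor_single:
  "Poly_Mapping.single g a \<otimes>\<^sub>W Poly_Mapping.single h b = Poly_Mapping.single (g, h) (a * b)"
  by (subst weyl_tensor_superset[of "{g}" "{h}"]) (auto split: if_splits)

lemma weyl_tensor_add:
  "(u + u') \<otimes>\<^sub>W v = u \<otimes>\<^sub>W v + u' \<otimes>\<^sub>W v"
  "v \<otimes>\<^sub>W (u + u') = v \<otimes>\<^sub>W u + v \<otimes>\<^sub>W u'"
proof -
  note keys = keys_add[of u u']
  show "(u + u') \<otimes>\<^sub>W v = u \<otimes>\<^sub>W v + u' \<otimes>\<^sub>W v"
    by (subst (1 2 3) weyl_tensor_superset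
          [of "Poly_Mapping.keys u \<union> Poly_Mapping.keys u'" "Poly_Mapping.keys v"])
       (use keys in \<open>auto simp: lookup_add distrib_right single_add sum.distrib\<close>)
  show "v \<otimes>\<^sub>W (u + u') = v \<otimes>\<^sub>W u + v \<otimes>\<^sub>W u'"
    by (subst (1 2 3) weyl_tensor_superset
          [of "Poly_Mapping.keys v" "Poly_Mapping.keys u \<union> Poly_Mapping.keys u'"])
       (use keys in \<open>auto simp: lookup_add distrib_left single_add sum.distrib\<close>)
qed

text \<open>The number \<open>xi_root N\<close> is a primitive 2N-th root of unity: its square is a
  primitive N-th root, as the collapse of the binomial theorem requires, and its N-th power -1 is
  the origin of the sign \<open>sN\<close>.\<close>

lemma xi_root_powers:
  assumes "N \<ge> 2"
  shows "xi_root N \<noteq> 0" "xi_root N ^ N = - 1" "(xi_root N ^ 2) ^ N = 1"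
    and "0 < i \<Longrightarrow> i < N \<Longrightarrow> (xi_root N ^ 2) ^ i \<noteq> 1"
proof -
  show "xi_root N \<noteq> 0" by (simp add: xi_root_def)
  have "xi_root N ^ N = exp (of_nat N * (pi * \<i> / N))"
    unfolding xi_root_def by (rule exp_of_nat_mult[symmetric])
  then show *: "xi_root N ^ N = - 1" using assms by (simp add: exp_pi_i)
  show "(xi_root N ^ 2) ^ N = 1"
    using * by (metis power_commutes power_mult power2_minus power_one mult.commute)
  assume i: "0 < i" "i < N"
  have cis: "(xi_root N ^ 2) ^ k = cis (2 * pi * real k / real N)" for k
  proof -
    have "(xi_root N ^ 2) ^ k = exp (of_nat (2 * k) * (pi * \<i> / N))"
      unfolding xi_root_def power_mult[symmetric] by (rule exp_of_nat_mult[symmetric])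
    then show ?thesis by (simp add: cis_conv_exp field_simps)
  qed
  have "inj_on (\<lambda>k. cis (2 * pi * real k / real N)) {..<N}"
    using bij_betw_roots_unity[of N] assms by (simp add: bij_betw_def)
  from inj_onD[OF this, of i 0] i show "(xi_root N ^ 2) ^ i \<noteq> 1"
    by (auto simp: cis)
qed

definition exp_lattice :: "nat \<Rightarrow> (weyl_exp \<times> weyl_exp) set" where
  "exp_lattice N = {((i, j, k), (i', j', k')). int N dvd i \<and> int N dvd j \<and> int N dvd k \<and>
     int N dvd i' \<and> int N dvd j' \<and> int N dvd k'}"

lemma keys_twisted_mult:
  "Poly_Mapping.keys (twisted_mult \<beta> f g)
     \<subseteq> {i + j | i j. i \<in> Poly_Mapping.keys f \<and> j \<in> Poly_Mapping.keys g}"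
  unfolding twisted_mult_def by (rule order_trans[OF keys_sum]) (force dest!: subsetD[OF keys_sum] split: if_splits)

text \<open>This is the bridge to the commutative ring structure of the type: wherever the twist is
  1, elements may be multiplied with \<open>*\<close> and simplified by the usual ring
  rules.\<close>

lemma twisted_mult_untwisted:
  assumes "\<And>i j. i \<in> Poly_Mapping.keys f \<Longrightarrow> j \<in> Poly_Mapping.keys g \<Longrightarrow> \<beta> i j = 1"
  shows "twisted_mult \<beta> f g = f * g"
proof -
  have "f * g = (\<Sum>i\<in>Poly_Mapping.keys f. Poly_Mapping.single i (Poly_Mapping.lookup f i))
      * (\<Sum>j\<in>Poly_Mapping.keys g. Poly_Mapping.single j (Poly_Mapping.lookup g j))"
    by (simp flip: poly_mapping_expand)
  then show ?thesis using assms
    by (simp add: twisted_mult_def sum_product mult_single)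
qed

lemma weyl_Z0_keys:
  assumes "u \<in> weyl_Z0 N" "(i, j, k) \<in> Poly_Mapping.keys u"
  shows "int N dvd i \<and> int N dvd j \<and> int N dvd k"
  using assms
proof (induction u arbitrary: i j k)
  case (add u v)
  then show ?case using keys_add[of u v] by blast
next
  case (mult u v)
  then obtain g h where "(i, j, k) = g + h" "g \<in> Poly_Mapping.keys u" "h \<in> Poly_Mapping.keys v"
    using keys_twisted_mult unfolding weyl_mult_def by blast
  then show ?case using mult.IH by (cases g; cases h) auto
qed (auto simp: zero_prod_def split: if_splits)

lemma weyl2_Z0_keys:
  assumes "u \<in> weyl2_Z0 N"
  shows "Poly_Mapping.keys u \<subseteq> exp_lattice N"
  using assms
proof (induction u)
  case (tensor u v)
  then show ?case unfolding weyl_tensor_def exp_lattice_def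
    by (intro order_trans[OF keys_sum])
       (auto dest!: subsetD[OF keys_sum] dest: weyl_Z0_keys split: if_splits)
next
  case (add u v)
  then show ?case using keys_add[of u v] by blast
qed

locale root_of_unity_index =
  fixes N :: nat
  assumes N_ge_2: "N \<ge> 2"
begin

abbreviation Z0 :: "weyl2 set" where "Z0 \<equiv> weyl2_Z0 N"

text \<open>
  The names \<open>xx1\<close>, \<open>yy1\<close>, \<open>zz1\<close>, \<open>xx2\<close>, \<open>yy2\<close>, \<open>zz2\<close> denote the $N$-th powers of the generators
  $x_1, \dots, z_2$, and a trailing \<open>i\<close> denotes the inverse.
\<close>

definition "xx1 = (Poly_Mapping.single ((int N, 0, 0), (0, 0, 0)) 1 :: weyl2)"
definition "yy1 = (Poly_Mapping.single ((0, int N, 0), (0, 0, 0)) 1 :: weyl2)"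
definition "zz1 = (Poly_Mapping.single ((0, 0, int N), (0, 0, 0)) 1 :: weyl2)"
definition "xx2 = (Poly_Mapping.single ((0, 0, 0), (int N, 0, 0)) 1 :: weyl2)"
definition "yy2 = (Poly_Mapping.single ((0, 0, 0), (0, int N, 0)) 1 :: weyl2)"
definition "zz2 = (Poly_Mapping.single ((0, 0, 0), (0, 0, int N)) 1 :: weyl2)"
definition "xx1i = (Poly_Mapping.single ((- int N, 0, 0), (0, 0, 0)) 1 :: weyl2)"
definition "yy1i = (Poly_Mapping.single ((0, - int N, 0), (0, 0, 0)) 1 :: weyl2)"
definition "zz1i = (Poly_Mapping.single ((0, 0, - int N), (0, 0, 0)) 1 :: weyl2)"
definition "xx2i = (Poly_Mapping.single ((0, 0, 0), (- int N, 0, 0)) 1 :: weyl2)"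
definition "yy2i = (Poly_Mapping.single ((0, 0, 0), (0, - int N, 0)) 1 :: weyl2)"
definition "zz2i = (Poly_Mapping.single ((0, 0, 0), (0, 0, - int N)) 1 :: weyl2)"

lemmas gen_defs = xx1_def yy1_def zz1_def xx2_def yy2_def zz2_def
  xx1i_def yy1i_def zz1i_def xx2i_def yy2i_def zz2i_def

lemma gen_inverse:
  "xx1 * xx1i = 1" "yy1 * yy1i = 1" "zz1 * zz1i = 1"
  "xx2 * xx2i = 1" "yy2 * yy2i = 1" "zz2 * zz2i = 1"
  by (simp_all add: gen_defs mult_single flip: zero_prod_def)

lemma weyl_twist_lattice:
  assumes "int N dvd j" "int N dvd i'"
  shows "weyl_twist (xi_root N) (i, j, k) (i', j', k') = 1"
proof -
  obtain a b where "j = int N * a" "i' = int N * b" using assms by (auto elim!: dvdE)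
  then have "- 2 * j * i' = 2 * int N * (- a * b * int N)" by simp
  then have "weyl_twist (xi_root N) (i, j, k) (i', j', k')
      = (xi_root N powi (2 * int N)) powi (- a * b * int N)"
    unfolding weyl_twist_def prod.case by (simp only: power_int_mult)
  also have "xi_root N powi (2 * int N) = 1"
    using xi_root_powers(3)[OF N_ge_2] by (simp add: power_int_mult)
  finally show ?thesis by simp
qed

lemma weyl2_twist_lattice:
  "g \<in> exp_lattice N \<Longrightarrow> h \<in> exp_lattice N \<Longrightarrow> weyl2_twist (xi_root N) g h = 1"
  by (auto simp: exp_lattice_def weyl2_twist_def weyl_twist_lattice)

lemma weyl2_mult_Z0:
  assumes "u \<in> Z0" "v \<in> Z0"
  shows "weyl2_mult (xi_root N) u v = u * v"
  unfolding weyl2_mult_eq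
  by (intro twisted_mult_untwisted weyl2_twist_lattice)
     (use assms[THEN weyl2_Z0_keys] in auto)

lemma Z0_add [intro]: "u \<in> Z0 \<Longrightarrow> v \<in> Z0 \<Longrightarrow> u + v \<in> Z0"
  by (rule weyl2_Z0.add)

lemma Z0_mult [intro]:
  assumes "u \<in> Z0" "v \<in> Z0"
  shows "u * v \<in> Z0"
proof -
  have "weyl2_mult (xi_root N) u v \<in> Z0" using assms
  proof (induction u)
    case (tensor a b)
    from tensor.prems show ?case
    proof (induction v)
      case (tensor c d)
      then show ?case using \<open>a \<in> _\<close> \<open>b \<in> _\<close>
        by (simp add: weyl2_mult_tensor weyl_Z0.mult weyl2_Z0.tensor)
    qed (auto simp: weyl2_mult_eq twisted_mult_add_right)
  qed (auto simp: weyl2_mult_eq twisted_mult_add_left)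
  then show ?thesis using assms by (simp add: weyl2_mult_Z0)
qed

lemma Z0_const [simp, intro]: "weyl2_const c \<in> Z0"
  using weyl2_Z0.tensor[OF weyl_Z0.const[of c] weyl_Z0.const[of 1]]
  by (simp add: weyl_tensor_single zero_prod_def)

lemma Z0_one [simp, intro]: "1 \<in> Z0" using Z0_const[of 1] by simp

lemma Z0_zero [simp, intro]: "0 \<in> Z0" using Z0_const[of 0] by simp

lemma Z0_uminus [intro]: "u \<in> Z0 \<Longrightarrow> - u \<in> Z0"
  using Z0_mult[OF Z0_const[of "- 1"], of u] by (simp add: single_uminus)

lemma Z0_diff [intro]: "u \<in> Z0 \<Longrightarrow> v \<in> Z0 \<Longrightarrow> u - v \<in> Z0"
  using Z0_add[of u "- v"] by auto

lemma tensor_one: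
  "weyl_monom i j k \<otimes>\<^sub>W weyl_const 1 = Poly_Mapping.single ((i, j, k), (0, 0, 0)) 1"
  "weyl_const 1 \<otimes>\<^sub>W weyl_monom i j k = Poly_Mapping.single ((0, 0, 0), (i, j, k)) 1"
  by (simp_all add: weyl_tensor_single zero_prod_def)

lemma gen_Z0 [simp, intro]:
  "xx1 \<in> Z0" "yy1 \<in> Z0" "zz1 \<in> Z0" "xx2 \<in> Z0" "yy2 \<in> Z0" "zz2 \<in> Z0"
  "xx1i \<in> Z0" "yy1i \<in> Z0" "zz1i \<in> Z0" "xx2i \<in> Z0" "yy2i \<in> Z0" "zz2i \<in> Z0"
  by (simp_all add: gen_defs tensor_one[symmetric] weyl2_Z0.tensor weyl_Z0.intros del: single_one)

text \<open>Since u \<otimes> v is the product of u \<otimes> 1 and 1 \<otimes> v, tensors reduce to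
  the N-th powers of the generators and their inverses. A multiplicative and additive property thus
  has to be checked on twelve elements and the scalars.\<close>

lemma Z0_induct [consumes 1, case_names const gen add mult]:
  assumes "u \<in> Z0" and const: "\<And>c. P (weyl2_const c)"
    and gen: "\<And>u. u \<in> {xx1, yy1, zz1, xx2, yy2, zz2, xx1i, yy1i, zz1i, xx2i, yy2i, zz2i} \<Longrightarrow> P u"
    and add: "\<And>u v. u \<in> Z0 \<Longrightarrow> v \<in> Z0 \<Longrightarrow> P u \<Longrightarrow> P v \<Longrightarrow> P (u + v)"
    and mult: "\<And>u v. u \<in> Z0 \<Longrightarrow> v \<in> Z0 \<Longrightarrow> P u \<Longrightarrow> P v \<Longrightarrow> P (u * v)"
  shows "P u"
proof -
  have m: "weyl_mult q u v \<otimes>\<^sub>W weyl_const 1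
      = weyl2_mult q (u \<otimes>\<^sub>W weyl_const 1) (v \<otimes>\<^sub>W weyl_const 1)"
    "weyl_const 1 \<otimes>\<^sub>W weyl_mult q u v
      = weyl2_mult q (weyl_const 1 \<otimes>\<^sub>W u) (weyl_const 1 \<otimes>\<^sub>W v)"
    "u \<otimes>\<^sub>W v = weyl2_mult q (u \<otimes>\<^sub>W weyl_const 1) (weyl_const 1 \<otimes>\<^sub>W v)" for q u v
    by (simp_all add: weyl2_mult_tensor weyl_mult_one del: single_one)
  have Z: "u \<otimes>\<^sub>W weyl_const 1 \<in> Z0" "weyl_const 1 \<otimes>\<^sub>W u \<in> Z0" if "u \<in> weyl_Z0 N" for u
    using that by (auto intro: weyl2_Z0.tensor weyl_Z0.const simp del: single_one)
  have left: "P (u \<otimes>\<^sub>W weyl_const 1)" if "u \<in> weyl_Z0 N" for u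
    using that
  proof (induction u)
    case (const c)
    then show ?case using assms(2)[of c]
      by (simp add: weyl_tensor_single zero_prod_def del: single_one)
  next
    case (add u v)
    then show ?case by (simp add: weyl_tensor_add assms(4) Z del: single_one)
  next
    case (mult u v)
    then show ?case by (simp add: m(1) weyl2_mult_Z0 assms(5) Z del: single_one)
  qed (simp_all only: tensor_one gen_defs[symmetric], auto intro: gen)
  have right: "P (weyl_const 1 \<otimes>\<^sub>W u)" if "u \<in> weyl_Z0 N" for u
    using that
  proof (induction u)
    case (const c)
    then show ?case using assms(2)[of c]
      by (simp add: weyl_tensor_single zero_prod_def del: single_one)
  next
    case (add u v)
    then show ?case by (simp add: weyl_tensor_add assms(4) Z del: single_one)
  next
    case (mult u v)
    then show ?case by (simp add: m(2) weyl2_mult_Z0 assms(5) Z del: single_one)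
  qed (simp_all only: tensor_one gen_defs[symmetric], auto intro: gen)
  show ?thesis using assms(1)
  proof (induction u)
    case (tensor u v)
    then show ?case unfolding m(3)[of u v "xi_root N"]
      by (simp add: weyl2_mult_Z0 assms(5) Z left right del: single_one)
  qed (rule add)
qed

end

section \<open>Points of the central torus as evaluations of monomials\<close>

definition monomial_eval ::
  "('g \<Rightarrow> complex) \<Rightarrow> ('g \<Rightarrow>\<^sub>0 complex) \<Rightarrow> complex" where
  "monomial_eval M w = (\<Sum>k\<in>Poly_Mapping.keys w. Poly_Mapping.lookup w k * M k)"

lemma monomial_eval_superset:
  "finite A \<Longrightarrow> Poly_Mapping.keys w \<subseteq> A \<Longrightarrow>
     monomial_eval M w = (\<Sum>k\<in>A. Poly_Mapping.lookup w k * M k)"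
  unfolding monomial_eval_def by (intro sum.mono_neutral_left) (auto simp: in_keys_iff)

lemma monomial_eval_single [simp]: "monomial_eval M (Poly_Mapping.single k c) = c * M k"
  by (subst monomial_eval_superset[of "{k}"]) (auto split: if_splits)

lemma monomial_eval_zero [simp]: "monomial_eval M 0 = 0"
  by (simp add: monomial_eval_def)

lemma monomial_eval_add: "monomial_eval M (u + v) = monomial_eval M u + monomial_eval M v"
  by (subst (1 2 3) monomial_eval_superset[of "Poly_Mapping.keys u \<union> Poly_Mapping.keys v"])
     (use keys_add[of u v] in \<open>auto simp: lookup_add distrib_right sum.distrib\<close>)

lemma monomial_eval_sum: "monomial_eval M (\<Sum>i\<in>I. f i) = (\<Sum>i\<in>I. monomial_eval M (f i))"
  by (induction I rule: infinite_finite_induct) (simp_all add: monomial_eval_add)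

lemma monomial_eval_mult:
  fixes u v :: "'g::comm_monoid_add \<Rightarrow>\<^sub>0 complex"
  assumes "\<And>k l. k \<in> Poly_Mapping.keys u \<Longrightarrow> l \<in> Poly_Mapping.keys v \<Longrightarrow> M (k + l) = M k * M l"
  shows "monomial_eval M (u * v) = monomial_eval M u * monomial_eval M v"
proof -
  have "u * v = (\<Sum>k\<in>Poly_Mapping.keys u. \<Sum>l\<in>Poly_Mapping.keys v.
      Poly_Mapping.single (k + l) (Poly_Mapping.lookup u k * Poly_Mapping.lookup v l))"
    by (subst poly_mapping_expand[of u], subst poly_mapping_expand[of v])
       (simp add: sum_product mult_single)
  then show ?thesis using assms
    by (simp add: monomial_eval_sum monomial_eval_def[of M u] monomial_eval_def[of M v]
        sum_product mult_ac)
qed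

context root_of_unity_index
begin

definition Z0_hom :: "(weyl2 \<Rightarrow> 'r::ring_1) \<Rightarrow> bool" where
  "Z0_hom f \<longleftrightarrow> f 1 = 1 \<and> (\<forall>u\<in>Z0. \<forall>v\<in>Z0. f (u + v) = f u + f v \<and> f (u * v) = f u * f v)"

lemma Z0_homD:
  assumes "Z0_hom f"
  shows "f 1 = 1" "f 0 = 0"
    and "u \<in> Z0 \<Longrightarrow> v \<in> Z0 \<Longrightarrow> f (u + v) = f u + f v"
    and "u \<in> Z0 \<Longrightarrow> v \<in> Z0 \<Longrightarrow> f (u * v) = f u * f v"
    and "u \<in> Z0 \<Longrightarrow> f (- u) = - f u"
    and "u \<in> Z0 \<Longrightarrow> v \<in> Z0 \<Longrightarrow> f (u - v) = f u - f v"
proof -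
  note h = assms[unfolded Z0_hom_def]
  show "f 1 = 1" using h by blast
  show add: "f (u + v) = f u + f v" if "u \<in> Z0" "v \<in> Z0" for u v using h that by blast
  show "u \<in> Z0 \<Longrightarrow> v \<in> Z0 \<Longrightarrow> f (u * v) = f u * f v" using h by blast
  show zero: "f 0 = 0" using add[of 0 0] by simp
  show um: "f (- u) = - f u" if "u \<in> Z0" for u
    using add[of u "- u"] that zero by (simp add: Z0_uminus add_eq_0_iff)
  show "u \<in> Z0 \<Longrightarrow> v \<in> Z0 \<Longrightarrow> f (u - v) = f u - f v"
    using add[of u "- v"] um by (simp add: Z0_uminus)
qed

text \<open>These are the complex points of the six-dimensional torus with coordinate ring
  \<open>Z0\<close>. As for characters, values outside \<open>Z0\<close> are left arbitrary.\<close>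

definition Z0_point :: "(weyl2 \<Rightarrow> complex) \<Rightarrow> bool" where
  "Z0_point \<psi> \<longleftrightarrow> Z0_hom \<psi> \<and> (\<forall>c. \<psi> (weyl2_const c) = c)"

lemma Z0_point_gen:
  assumes "Z0_point \<psi>"
  shows "\<psi> xx1i = inverse (\<psi> xx1)" "\<psi> yy1i = inverse (\<psi> yy1)" "\<psi> zz1i = inverse (\<psi> zz1)"
    "\<psi> xx2i = inverse (\<psi> xx2)" "\<psi> yy2i = inverse (\<psi> yy2)" "\<psi> zz2i = inverse (\<psi> zz2)"
    "\<psi> xx1 \<noteq> 0" "\<psi> yy1 \<noteq> 0" "\<psi> zz1 \<noteq> 0" "\<psi> xx2 \<noteq> 0" "\<psi> yy2 \<noteq> 0" "\<psi> zz2 \<noteq> 0"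
proof -
  have *: "\<psi> u * \<psi> v = 1" if "u * v = 1" "u \<in> Z0" "v \<in> Z0" for u v
    using assms that by (metis Z0_homD(1,4) Z0_point_def)
  note i = gen_inverse[THEN *, simplified]
  show "\<psi> xx1i = inverse (\<psi> xx1)" "\<psi> yy1i = inverse (\<psi> yy1)" "\<psi> zz1i = inverse (\<psi> zz1)"
    "\<psi> xx2i = inverse (\<psi> xx2)" "\<psi> yy2i = inverse (\<psi> yy2)" "\<psi> zz2i = inverse (\<psi> zz2)"
    using i[THEN inverse_unique] by simp_all
  show "\<psi> xx1 \<noteq> 0" "\<psi> yy1 \<noteq> 0" "\<psi> zz1 \<noteq> 0" "\<psi> xx2 \<noteq> 0" "\<psi> yy2 \<noteq> 0" "\<psi> zz2 \<noteq> 0"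
    using i by auto
qed

text \<open>Multiplicativity is demanded on the lattice only, so that the lemma covers
  \<open>character_tensor\<close>, whose factors are multiplicative just on the central subalgebra,
  as well as \<open>torus_monomial\<close>.\<close>

lemma Z0_point_monomial_eval:
  assumes "\<And>k l. k \<in> exp_lattice N \<Longrightarrow> l \<in> exp_lattice N \<Longrightarrow> M (k + l) = M k * M l" "M 0 = 1"
  shows "Z0_point (monomial_eval M)"
  unfolding Z0_point_def Z0_hom_def
proof (intro conjI ballI allI)
  fix u v assume "u \<in> Z0" "v \<in> Z0"
  then show "monomial_eval M (u * v) = monomial_eval M u * monomial_eval M v"
    by (intro monomial_eval_mult assms(1)) (auto dest: weyl2_Z0_keys)
next
  show "monomial_eval M 1 = 1"
    using monomial_eval_single[of M 0 1] assms(2) by simp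
qed (simp_all add: monomial_eval_add assms(2))

definition torus_monomial ::
  "complex \<times> complex \<times> complex \<times> complex \<times> complex \<times> complex \<Rightarrow> weyl_exp \<times> weyl_exp \<Rightarrow> complex" where
  "torus_monomial = (\<lambda>(a, b, c, a', b', c') ((i, j, k), (i', j', k')).
     a powi i * b powi j * c powi k * a' powi i' * b' powi j' * c' powi k')"

definition torus :: "(complex \<times> complex \<times> complex \<times> complex \<times> complex \<times> complex) set" where
  "torus = {(a, b, c, a', b', c'). a \<noteq> 0 \<and> b \<noteq> 0 \<and> c \<noteq> 0 \<and> a' \<noteq> 0 \<and> b' \<noteq> 0 \<and> c' \<noteq> 0}"

lemma Z0_point_torus: "t \<in> torus \<Longrightarrow> Z0_point (monomial_eval (torus_monomial t))"
  by (intro Z0_point_monomial_eval)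
     (auto simp: torus_def torus_monomial_def power_int_add zero_prod_def)

lemma Z0_point_exists:
  assumes "a1 \<noteq> 0" "b1 \<noteq> 0" "m1 \<noteq> 0" "a2 \<noteq> 0" "b2 \<noteq> 0" "m2 \<noteq> 0"
  obtains \<psi> where "Z0_point \<psi>" "\<psi> xx1 = a1" "\<psi> yy1 = b1" "\<psi> zz1 = m1"
    "\<psi> xx2 = a2" "\<psi> yy2 = b2" "\<psi> zz2 = m2"
proof -
  have N: "0 < N" using N_ge_2 by simp
  \<comment> \<open>A torus point gives values to x, y, z themselves, whereas the prescribed numbers
    are values of their N-th powers; hence the roots.\<close>
  obtain r1 s1 t1 r2 s2 t2 where r: "r1 ^ N = a1" "s1 ^ N = b1" "t1 ^ N = m1"
      "r2 ^ N = a2" "s2 ^ N = b2" "t2 ^ N = m2"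
    using complex_nth_root_exists[OF N] by metis
  have "(r1, s1, t1, r2, s2, t2) \<in> torus"
    using assms N unfolding torus_def r[symmetric] by auto
  from that[OF Z0_point_torus[OF this]] r show ?thesis
    by (simp add: gen_defs torus_monomial_def)
qed

text \<open>Points separate the elements of \<open>Z0\<close>: the monomials are distinct characters
  of the torus, so all coefficients of a difference vanishing at every point are zero.\<close>

lemma Z0_point_eqI:
  assumes "u \<in> Z0" "v \<in> Z0" "\<And>\<psi>. Z0_point \<psi> \<Longrightarrow> \<psi> u = \<psi> v"
  shows "u = v"
proof -
  have *: "\<psi> (u - v) = 0" if "Z0_point \<psi>" for \<psi>
    using assms that by (simp add: Z0_point_def Z0_homD(6))
  have "Poly_Mapping.lookup (u - v) g = 0" if g: "g \<in> Poly_Mapping.keys (u - v)" for g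
  proof (rule dedekind_independence[where T = torus and M = torus_monomial
        and S = "Poly_Mapping.keys (u - v)"
        and mul = "\<lambda>(a, b, c, a', b', c') (d, e, f, d', e', f').
              (a * d, b * e, c * f, a' * d', b' * e', c' * f')"])
    have "(1, 1, 1, 1, 1, 1) \<in> torus" by (simp add: torus_def)
    then show "torus \<noteq> {}" by blast
    show "(\<Sum>g\<in>Poly_Mapping.keys (u - v). Poly_Mapping.lookup (u - v) g * torus_monomial t g) = 0"
      if "t \<in> torus" for t
      using *[OF Z0_point_torus[OF that]] by (simp add: monomial_eval_def)
    show "\<exists>t\<in>torus. torus_monomial t g \<noteq> torus_monomial t h" if "g \<noteq> h" for g h
    proof -
      \<comment> \<open>Torus points with one coordinate 2 and the others 1 read off each exponent,
        because integer powers of 2 are distinct.\<close>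
      have p: "2 powi i = (2 powi j :: complex) \<longleftrightarrow> i = j" for i j
      proof -
        have "(2::complex) powi i = of_real (2 powi i)" for i by simp
        then have "2 powi i = (2 powi j :: complex) \<longleftrightarrow> (2::real) powi i = 2 powi j"
          by (metis of_real_eq_iff)
        moreover have "(2::real) powi i \<noteq> 2 powi j" if "i \<noteq> j"
          using that power_int_strict_increasing[of i j "2::real"]
            power_int_strict_increasing[of j i "2::real"] by (cases i j rule: linorder_cases) auto
        ultimately show ?thesis by auto
      qed
      show ?thesis
      proof (rule ccontr)
        assume "\<not> ?thesis"
        then have eq: "torus_monomial t g = torus_monomial t h" if "t \<in> torus" for t
          using that by blast
        obtain i j k i' j' k' where g: "g = ((i, j, k), (i', j', k'))" by (metis surj_pair)
        obtain l m n l' m' n' where h: "h = ((l, m, n), (l', m', n'))" by (metis surj_pair)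
        have "i = l \<and> j = m \<and> k = n \<and> i' = l' \<and> j' = m' \<and> k' = n'"
          using eq[of "(2, 1, 1, 1, 1, 1)"] eq[of "(1, 2, 1, 1, 1, 1)"] eq[of "(1, 1, 2, 1, 1, 1)"]
            eq[of "(1, 1, 1, 2, 1, 1)"] eq[of "(1, 1, 1, 1, 2, 1)"] eq[of "(1, 1, 1, 1, 1, 2)"]
          by (simp add: torus_def torus_monomial_def g h p)
        then show False using \<open>g \<noteq> h\<close> by (simp add: g h)
      qed
    qed
  qed (use g in \<open>auto simp: torus_def torus_monomial_def power_int_mult_distrib\<close>)
  then have "Poly_Mapping.keys (u - v) = {}" using in_keys_iff by blast
  then show ?thesis by (simp only: keys_eq_empty eq_iff_diff_eq_0[of u v])
qed

lemma weyl_Z0_monom: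
  assumes "int N dvd i" "int N dvd j" "int N dvd k"
  shows "weyl_monom i j k \<in> weyl_Z0 N"
proof -
  have q: "xi_root N \<noteq> 0" using xi_root_powers[OF N_ge_2] by simp
  have pow: "weyl_monom (int N * i) 0 0 \<in> weyl_Z0 N \<and> weyl_monom 0 (int N * i) 0 \<in> weyl_Z0 N \<and>
      weyl_monom 0 0 (int N * i) \<in> weyl_Z0 N" for i
  proof (induction i rule: int_induct[where k = 0])
    case base
    show ?case using weyl_Z0.const[of 1 N] by (simp flip: zero_prod_def)
  next
    case (step1 i)
    then have "weyl_mult (xi_root N) (weyl_monom (int N * i) 0 0) (weyl_monom (int N) 0 0) \<in> weyl_Z0 N"
      "weyl_mult (xi_root N) (weyl_monom 0 (int N * i) 0) (weyl_monom 0 (int N) 0) \<in> weyl_Z0 N"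
      "weyl_mult (xi_root N) (weyl_monom 0 0 (int N * i)) (weyl_monom 0 0 (int N)) \<in> weyl_Z0 N"
      by (auto intro: weyl_Z0.intros)
    then show ?case by (simp add: weyl_mult_single distrib_left)
  next
    case (step2 i)
    then have "weyl_mult (xi_root N) (weyl_monom (int N * i) 0 0) (weyl_monom (- int N) 0 0) \<in> weyl_Z0 N"
      "weyl_mult (xi_root N) (weyl_monom 0 (int N * i) 0) (weyl_monom 0 (- int N) 0) \<in> weyl_Z0 N"
      "weyl_mult (xi_root N) (weyl_monom 0 0 (int N * i)) (weyl_monom 0 0 (- int N)) \<in> weyl_Z0 N"
      by (auto intro: weyl_Z0.intros)
    then show ?case by (simp add: weyl_mult_single right_diff_distrib)
  qed
  show ?thesis
    by (subst weyl_relations(6)[OF q]) (use assms pow in \<open>auto intro!: weyl_Z0.mult elim!: dvdE\<close>)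
qed

lemma Z0_point_character_tensor:
  assumes "is_character N \<chi>1" "is_character N \<chi>2"
  shows "Z0_point (character_tensor \<chi>1 \<chi>2)"
proof -
  let ?M = "\<lambda>(g, h). \<chi>1 (Poly_Mapping.single g 1) * \<chi>2 (Poly_Mapping.single h 1)"
  have eq: "character_tensor \<chi>1 \<chi>2 = monomial_eval ?M"
    by (auto simp: character_tensor_def monomial_eval_def fun_eq_iff intro!: sum.cong)
  have mult: "\<chi> (weyl_monom (i + i') (j + j') (k + k')) = \<chi> (weyl_monom i j k) * \<chi> (weyl_monom i' j' k')"
    if "is_character N \<chi>" "int N dvd i" "int N dvd j" "int N dvd k"
      "int N dvd i'" "int N dvd j'" "int N dvd k'" for \<chi> i j k i' j' k'
  proof -
    have "weyl_mult (xi_root N) (weyl_monom i j k) (weyl_monom i' j' k')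
        = weyl_monom (i + i') (j + j') (k + k')"
      using weyl_twist_lattice[of j i' i k j' k'] that(2-)
      by (simp add: weyl_mult_def twisted_mult_single)
    then show ?thesis using that weyl_Z0_monom by (metis is_character_def)
  qed
  have one: "\<chi> (weyl_const 1) = 1" if "is_character N \<chi>" for \<chi>
    using that by (simp add: is_character_def del: single_one)
  show ?thesis unfolding eq
    by (rule Z0_point_monomial_eval)
       (use assms in \<open>auto simp: exp_lattice_def mult zero_prod_def one[unfolded zero_prod_def]\<close>)
qed

lemma character_tensor_gen:
  assumes "is_character N \<chi>1" "is_character N \<chi>2"
  shows "character_tensor \<chi>1 \<chi>2 xx1 = \<chi>1 (weyl_monom (int N) 0 0)"
    "character_tensor \<chi>1 \<chi>2 yy1 = \<chi>1 (weyl_monom 0 (int N) 0)"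
    "character_tensor \<chi>1 \<chi>2 zz1 = \<chi>1 (weyl_monom 0 0 (int N))"
    "character_tensor \<chi>1 \<chi>2 xx2 = \<chi>2 (weyl_monom (int N) 0 0)"
    "character_tensor \<chi>1 \<chi>2 yy2 = \<chi>2 (weyl_monom 0 (int N) 0)"
    "character_tensor \<chi>1 \<chi>2 zz2 = \<chi>2 (weyl_monom 0 0 (int N))"
proof -
  have "\<chi> (weyl_monom 0 0 0) = 1" if "is_character N \<chi>" for \<chi>
    using that by (simp add: is_character_def zero_prod_def del: single_one)
  then show "character_tensor \<chi>1 \<chi>2 xx1 = \<chi>1 (weyl_monom (int N) 0 0)"
    "character_tensor \<chi>1 \<chi>2 yy1 = \<chi>1 (weyl_monom 0 (int N) 0)"
    "character_tensor \<chi>1 \<chi>2 zz1 = \<chi>1 (weyl_monom 0 0 (int N))"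
    "character_tensor \<chi>1 \<chi>2 xx2 = \<chi>2 (weyl_monom (int N) 0 0)"
    "character_tensor \<chi>1 \<chi>2 yy2 = \<chi>2 (weyl_monom 0 (int N) 0)"
    "character_tensor \<chi>1 \<chi>2 zz2 = \<chi>2 (weyl_monom 0 0 (int N))"
    using assms by (simp_all add: character_tensor_def gen_defs)
qed


section \<open>Homomorphisms from the tensor square and powers of monomials\<close>

abbreviation q :: complex where "q \<equiv> xi_root N"

lemma q_nonzero [simp]: "q \<noteq> 0"
  using xi_root_powers[OF N_ge_2] by simp

lemma weyl2_homD:
  assumes "is_weyl2_hom q f"
  shows "f (weyl2_const 1) = 1" "f (u + v) = f u + f v" "f (weyl2_mult q u v) = f u * f v"
    "f 0 = 0"
    "f (Poly_Mapping.single k c) + f (Poly_Mapping.single k d) = f (Poly_Mapping.single k (c + d))"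
    "- f (Poly_Mapping.single k c) = f (Poly_Mapping.single k (- c))"
    "f (Poly_Mapping.single k c) * f (Poly_Mapping.single l d)
       = f (Poly_Mapping.single (k + l) (weyl2_twist q k l * c * d))"
proof -
  show *: "f (weyl2_const 1) = 1" "f (u + v) = f u + f v" "f (weyl2_mult q u v) = f u * f v" for u v
    using assms unfolding is_weyl2_hom_def by blast+
  show zero: "f 0 = 0" using *(2)[of 0 0] by simp
  show add: "f (Poly_Mapping.single k c) + f (Poly_Mapping.single k d)
      = f (Poly_Mapping.single k (c + d))" for c d
    by (simp add: *(2)[symmetric] single_add)
  show "- f (Poly_Mapping.single k c) = f (Poly_Mapping.single k (- c))"
    using add[of c "- c"] zero by (simp add: minus_unique)
  show "f (Poly_Mapping.single k c) * f (Poly_Mapping.single l d)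
       = f (Poly_Mapping.single (k + l) (weyl2_twist q k l * c * d))"
    by (simp add: *(3)[symmetric] weyl2_mult_eq twisted_mult_single)
qed

lemma Z0_hom_weyl2_hom:
  assumes "is_weyl2_hom q f"
  shows "Z0_hom f"
  unfolding Z0_hom_def using weyl2_homD(1-3)[OF assms] by (metis weyl2_mult_Z0 single_one)

lemma weyl2_hom_const:
  fixes f :: "weyl2 \<Rightarrow> 'r::ring_1"
  assumes "is_weyl2_hom q f"
  defines "c \<equiv> (\<lambda>a. f (weyl2_const a))"
  shows "c 0 = 0" "c 1 = 1" "\<And>a b. c (a + b) = c a + c b" "\<And>a b. c (a * b) = c a * c b"
    "c a * f u = f u * c a"
proof -
  have tw: "weyl2_twist q 0 k = 1" "weyl2_twist q k 0 = 1" for k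
    by (auto simp: weyl2_twist_def weyl_twist_def zero_prod_def split: prod.splits)
  show "c 0 = 0" "c 1 = 1" "\<And>a b. c (a + b) = c a + c b" "\<And>a b. c (a * b) = c a * c b"
    using weyl2_homD[OF assms(1)] by (simp_all add: c_def tw)
  show "c a * f u = f u * c a"
    by (induction u rule: poly_mapping_linear_induct)
       (simp_all add: c_def weyl2_homD[OF assms(1)] tw mult.commute distrib_left distrib_right
         del: single_one)
qed

text \<open>The sign $q^{N(N-1)}$ produced by reordering the $N$-th power of a monomial such as $xy$.\<close>

definition sN :: complex where "sN = (- 1) ^ (N - 1)"

lemma sN: "(- 1) ^ N = - sN" "sN * sN = 1" "sN * (sN * x) = x" "sN powi (- 1) = sN" "inverse sN = sN"
  "sN \<noteq> 0"
proof -
  show "(- 1) ^ N = - sN"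
    unfolding sN_def using power_minus_mult[of N "- 1 :: complex"] N_ge_2 by simp
  show *: "sN * sN = 1" by (simp add: sN_def flip: power_add mult_2)
  then show "sN * (sN * x) = x" by (simp flip: mult.assoc)
  show "inverse sN = sN" "sN \<noteq> 0" using * inverse_unique by auto
  then show "sN powi (- 1) = sN" by simp
qed

text \<open>Multiplying the n-th power by one more factor costs q^{-2n(ji + j'i')}, and 2(0 + 1 +
  ... + (n-1)) = n(n-1).\<close>

lemma weyl2_hom_power:
  assumes "is_weyl2_hom q f"
  shows "f (Poly_Mapping.single ((i, j, k), (i', j', k')) c) ^ n
    = f (Poly_Mapping.single ((int n * i, int n * j, int n * k), (int n * i', int n * j', int n * k'))
          (c ^ n * q powi (- (int n * (int n - 1)) * (j * i + j' * i'))))"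
proof (induction n)
  case 0
  show ?case using weyl2_homD(1)[OF assms] by (simp add: zero_prod_def)
next
  case (Suc n)
  have "q powi (- 2 * j * (int n * i)) * q powi (- 2 * j' * (int n * i'))
        * (q powi (- (int n * (int n - 1)) * (j * i + j' * i')))
      = q powi (- (int (Suc n) * (int (Suc n) - 1)) * (j * i + j' * i'))"
    by (simp add: algebra_simps flip: power_int_add)
  then show ?case
    by (simp add: Suc weyl2_homD(7)[OF assms] weyl2_twist_def weyl_twist_def algebra_simps)
qed

lemma weyl2_hom_power_N:
  assumes "is_weyl2_hom q f"
  shows "f (Poly_Mapping.single ((i, j, k), (i', j', k')) c) ^ N
    = f (Poly_Mapping.single ((int N * i, int N * j, int N * k), (int N * i', int N * j', int N * k'))
          (c ^ N * sN powi (j * i + j' * i')))"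
proof -
  have "int N * (int N - 1) = int (N * (N - 1))" using N_ge_2 by (simp add: of_nat_diff)
  then have "q powi (int N * (int N - 1)) = (q ^ N) ^ (N - 1)"
    by (simp only: power_int_of_nat power_mult)
  also have "\<dots> = sN" using xi_root_powers(2)[OF N_ge_2] by (simp add: sN_def)
  finally have "q powi (- (int N * (int N - 1)) * (j * i + j' * i')) = (inverse sN) powi (j * i + j' * i')"
    by (simp add: power_int_mult power_int_minus flip: power_int_inverse)
  then show ?thesis by (simp add: weyl2_hom_power[OF assms] sN)
qed

end

section \<open>Values of rational functions on the central torus\<close>

lemma division_ring_divide_mult_cancel:
  "b \<noteq> 0 \<Longrightarrow> a / b * b = (a :: 'd::division_ring)"
  by (simp add: divide_inverse mult.assoc)

lemma division_ring_eq_divideI: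
  fixes a b c :: "'d::division_ring"
  assumes "b \<noteq> 0" "a * b = c"
  shows "a = c / b"
  using assms by (auto simp: divide_inverse mult.assoc)

text \<open>Cross multiplication needs commuting denominators in a noncommutative ring. All
  fractions handled later have numerator and denominator in the commuting image of \<open>Z0\<close>
  under \<open>\<iota>\<close> or \<open>R\<close>.\<close>

lemma division_ring_fraction_eq_iff:
  fixes a b c d :: "'d::division_ring"
  assumes "b \<noteq> 0" "d \<noteq> 0" "b * d = d * b"
  shows "a / b = c / d \<longleftrightarrow> a * d = c * b"
proof -
  have 1: "a / b * b = a" and 2: "c / d * d = c"
    by (rule division_ring_divide_mult_cancel; fact)+
  have "a / b = c / d \<longleftrightarrow> a / b * (b * d) = c / d * (b * d)"
    using assms(1,2) by (simp del: times_divide_eq_left times_divide_eq_right)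
  also have "a / b * (b * d) = a * d" by (simp only: mult.assoc[symmetric] 1)
  also have "c / d * (b * d) = c * b" by (simp only: assms(3)) (simp only: mult.assoc[symmetric] 2)
  finally show ?thesis .
qed

lemma division_ring_fraction_add:
  fixes a b c d :: "'d::division_ring"
  assumes "b \<noteq> 0" "d \<noteq> 0" "b * d = d * b"
  shows "a / b + c / d = (a * d + c * b) / (b * d)"
proof (rule division_ring_eq_divideI)
  have 1: "a / b * b = a" and 2: "c / d * d = c"
    by (rule division_ring_divide_mult_cancel; fact)+
  have "a / b * (b * d) = a * d" by (simp only: mult.assoc[symmetric] 1)
  moreover have "c / d * (b * d) = c * b"
    by (simp only: assms(3)) (simp only: mult.assoc[symmetric] 2)
  ultimately show "(a / b + c / d) * (b * d) = a * d + c * b" by (simp only: distrib_right)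
qed (use assms in simp)

lemma division_ring_fraction_mult:
  fixes a b c d :: "'d::division_ring"
  assumes "b \<noteq> 0" "d \<noteq> 0" "b * d = d * b" "b * c = c * b"
  shows "(a / b) * (c / d) = (a * c) / (b * d)"
proof (rule division_ring_eq_divideI)
  have 1: "a / b * b = a" and 2: "c / d * d = c"
    by (rule division_ring_divide_mult_cancel; fact)+
  have "(a / b) * (c / d) * (b * d) = a / b * ((c / d * d) * b)"
    by (simp only: assms(3) mult.assoc)
  also have "\<dots> = (a / b * b) * c"
    by (simp only: 2 mult.assoc assms(4))
  finally show "(a / b) * (c / d) * (b * d) = a * c" by (simp only: 1)
qed (use assms in simp)

lemma division_ring_inverse_commute:
  fixes a b :: "'d::division_ring"
  assumes "a * b = b * a"
  shows "a * inverse b = inverse b * a"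
proof (cases "b = 0")
  case False
  have "a * inverse b = inverse b * (b * a) * inverse b" using False by (simp flip: mult.assoc)
  also have "\<dots> = inverse b * a" using False by (simp add: assms[symmetric] mult.assoc)
  finally show ?thesis .
qed simp

context root_of_unity_index
begin

lemma Z0_hom_commute:
  "Z0_hom f \<Longrightarrow> u \<in> Z0 \<Longrightarrow> v \<in> Z0 \<Longrightarrow> f u * f v = f v * f u"
  by (metis Z0_homD(4) mult.commute)

end

locale weyl2_fractions = root_of_unity_index N for N +
  fixes \<iota> :: "weyl2 \<Rightarrow> 'd::division_ring"
  assumes fractions: "is_weyl2_fractions (xi_root N) \<iota>"
begin

lemma \<iota>_weyl2_hom: "is_weyl2_hom q \<iota>"
  using fractions by (simp add: is_weyl2_fractions_def)

lemma \<iota>_hom: "Z0_hom \<iota>"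
  by (rule Z0_hom_weyl2_hom[OF \<iota>_weyl2_hom])

lemmas \<iota>_simps = Z0_homD[OF \<iota>_hom]

lemma \<iota>_inj: "\<iota> u = \<iota> v \<longleftrightarrow> u = v"
  using fractions by (auto simp: is_weyl2_fractions_def inj_def)

lemma \<iota>_eq_0 [simp]: "\<iota> u = 0 \<longleftrightarrow> u = 0"
  using \<iota>_inj[of u 0] \<iota>_simps(2) by simp

lemmas \<iota>_commute = Z0_hom_commute[OF \<iota>_hom]

lemma Z0_no_zero_divisors: "u \<in> Z0 \<Longrightarrow> v \<in> Z0 \<Longrightarrow> u * v = 0 \<longleftrightarrow> u = 0 \<or> v = 0"
  using \<iota>_eq_0[of "u * v"] by (simp add: \<iota>_simps(4))

text \<open>The binomial theorem requires scalars central in all of \<open>'d\<close>. They commute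
  with the image of \<open>\<iota>\<close>, hence also with inverses of its elements, and every
  element of \<open>'d\<close> is a fraction of such images.\<close>

lemma const_central: "\<iota> (weyl2_const a) * d = d * \<iota> (weyl2_const a)"
proof -
  obtain u v where d: "d = \<iota> u * inverse (\<iota> v)"
    using fractions by (metis is_weyl2_fractions_def divide_inverse)
  note c = weyl2_hom_const(5)[OF \<iota>_weyl2_hom, of a]
  show ?thesis
    unfolding d mult.assoc[symmetric] c[of u]
    unfolding mult.assoc division_ring_inverse_commute[OF c] ..
qed

lemma power_N_add:
  assumes "U * V = \<iota> (weyl2_const (q ^ 2)) * (V * U)"
  shows "(U + V) ^ N = U ^ N + V ^ N"
proof (rule power_add_q_commuting[where c = "\<lambda>a. \<iota> (weyl2_const a)" and s = "q ^ 2"])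
  show "\<iota> (weyl2_const a) * r = r * \<iota> (weyl2_const a)" for a r by (rule const_central)
  show "(q ^ 2) ^ i \<noteq> 1" if "0 < i" "i < N" for i
    by (rule xi_root_powers(4)[OF N_ge_2 that])
  show "(q ^ 2) ^ N = 1" by (rule xi_root_powers(3)[OF N_ge_2])
  show "0 < N" using N_ge_2 by simp
qed (fact weyl2_hom_const(1-4)[OF \<iota>_weyl2_hom] assms)+

abbreviation e :: "weyl_exp \<times> weyl_exp \<Rightarrow> complex \<Rightarrow> 'd" where
  "e k c \<equiv> \<iota> (Poly_Mapping.single k c)"

lemmas e_simps = weyl2_homD(5-7)[OF \<iota>_weyl2_hom]

lemma e_const_mult: "\<iota> (weyl2_const a) * e k c = e k (a * c)"
proof -
  have "weyl2_twist q 0 k = 1"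
    by (auto simp: weyl2_twist_def weyl_twist_def zero_prod_def split: prod.splits)
  then show ?thesis by (simp add: e_simps)
qed

lemma e_power_N_add:
  assumes "weyl2_twist q k l = q ^ 2 * weyl2_twist q l k"
  shows "(e k c + e l d) ^ N = e k c ^ N + e l d ^ N"
  by (rule power_N_add)
     (simp only: e_simps(3)[of k c l d] e_simps(3)[of l d k c] e_const_mult assms add.commute[of k l]
        mult.assoc mult.commute[of c d])

abbreviation val :: "'d \<Rightarrow> (weyl2 \<Rightarrow> complex) \<Rightarrow> complex \<Rightarrow> bool" where
  "val \<equiv> has_value_at N \<iota>"

lemma Z0_point_nonzero: "Z0_point \<psi> \<Longrightarrow> \<psi> v \<noteq> 0 \<Longrightarrow> \<iota> v \<noteq> 0"
  using Z0_homD(2) by (auto simp: Z0_point_def)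

lemma val_\<iota>: "Z0_point \<psi> \<Longrightarrow> u \<in> Z0 \<Longrightarrow> val (\<iota> u) \<psi> (\<psi> u)"
  unfolding has_value_at_def
  by (intro bexI[of _ u] bexI[of _ 1]) (auto simp: \<iota>_simps Z0_point_def Z0_homD)

text \<open>Cross multiplication turns two representing fractions into an equation in
  \<open>Z0\<close>, by injectivity of \<open>\<iota>\<close>, and a point may then be applied to
  it. So the value depends only on the element of \<open>'d\<close>.\<close>

lemma val_unique:
  assumes \<psi>: "Z0_point \<psi>" and "val w \<psi> r" "val w \<psi> s"
  shows "r = s"
proof -
  note h = \<psi>[unfolded Z0_point_def, THEN conjunct1, THEN Z0_homD(4)]
  obtain u v where u: "u \<in> Z0" "v \<in> Z0" "\<psi> v \<noteq> 0" "w = \<iota> u / \<iota> v" "r = \<psi> u / \<psi> v"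
    using assms by (auto simp: has_value_at_def)
  obtain u' v' where u': "u' \<in> Z0" "v' \<in> Z0" "\<psi> v' \<noteq> 0" "w = \<iota> u' / \<iota> v'" "s = \<psi> u' / \<psi> v'"
    using assms by (auto simp: has_value_at_def)
  have "\<iota> u * \<iota> v' = \<iota> u' * \<iota> v"
    using u u' Z0_point_nonzero[OF \<psi>] \<iota>_commute[of v v']
      division_ring_fraction_eq_iff[of "\<iota> v" "\<iota> v'" "\<iota> u" "\<iota> u'"] by metis
  then have "u * v' = u' * v" using u u' by (simp add: \<iota>_inj flip: \<iota>_simps(4))
  then have "\<psi> u * \<psi> v' = \<psi> u' * \<psi> v" using u u' by (metis h)
  then show ?thesis using u(3,5) u'(3,5) by (simp add: frac_eq_eq)
qed

lemma val_add:
  assumes \<psi>: "Z0_point \<psi>" and "val w \<psi> r" "val w' \<psi> s"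
  shows "val (w + w') \<psi> (r + s)"
proof -
  note h = \<psi>[unfolded Z0_point_def, THEN conjunct1, THEN Z0_homD(3)]
    \<psi>[unfolded Z0_point_def, THEN conjunct1, THEN Z0_homD(4)]
  obtain u v where u: "u \<in> Z0" "v \<in> Z0" "\<psi> v \<noteq> 0" "w = \<iota> u / \<iota> v" "r = \<psi> u / \<psi> v"
    using assms by (auto simp: has_value_at_def)
  obtain u' v' where u': "u' \<in> Z0" "v' \<in> Z0" "\<psi> v' \<noteq> 0" "w' = \<iota> u' / \<iota> v'" "s = \<psi> u' / \<psi> v'"
    using assms by (auto simp: has_value_at_def)
  have "w + w' = \<iota> (u * v' + u' * v) / \<iota> (v * v')"
    using u u' Z0_point_nonzero[OF \<psi>] \<iota>_commute[of v v']
    by (simp add: division_ring_fraction_add \<iota>_simps Z0_mult)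
  moreover have "r + s = \<psi> (u * v' + u' * v) / \<psi> (v * v')"
    using u u' by (simp add: h Z0_mult add_frac_eq)
  moreover have "\<psi> (v * v') \<noteq> 0" using u u' by (simp add: h)
  ultimately show ?thesis unfolding has_value_at_def using u u' by blast
qed

lemma val_mult:
  assumes \<psi>: "Z0_point \<psi>" and "val w \<psi> r" "val w' \<psi> s"
  shows "val (w * w') \<psi> (r * s)"
proof -
  note h = \<psi>[unfolded Z0_point_def, THEN conjunct1, THEN Z0_homD(4)]
  obtain u v where u: "u \<in> Z0" "v \<in> Z0" "\<psi> v \<noteq> 0" "w = \<iota> u / \<iota> v" "r = \<psi> u / \<psi> v"
    using assms by (auto simp: has_value_at_def)
  obtain u' v' where u': "u' \<in> Z0" "v' \<in> Z0" "\<psi> v' \<noteq> 0" "w' = \<iota> u' / \<iota> v'" "s = \<psi> u' / \<psi> v'"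
    using assms by (auto simp: has_value_at_def)
  have "w * w' = \<iota> (u * u') / \<iota> (v * v')"
    using u u' Z0_point_nonzero[OF \<psi>] \<iota>_commute[of v v'] \<iota>_commute[of v u']
    by (simp only: division_ring_fraction_mult \<iota>_simps not_False_eq_True)
  moreover have "r * s = \<psi> (u * u') / \<psi> (v * v')" "\<psi> (v * v') \<noteq> 0"
    using u u' by (simp_all add: h)
  ultimately show ?thesis unfolding has_value_at_def using u u' by blast
qed

lemma val_inverse:
  assumes \<psi>: "Z0_point \<psi>" and "val w \<psi> r" "r \<noteq> 0"
  shows "val (inverse w) \<psi> (inverse r)"
proof -
  obtain u v where u: "u \<in> Z0" "v \<in> Z0" "\<psi> v \<noteq> 0" "w = \<iota> u / \<iota> v" "r = \<psi> u / \<psi> v"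
    using assms by (auto simp: has_value_at_def)
  moreover have "inverse w = \<iota> v / \<iota> u"
    using u assms(3) Z0_point_nonzero[OF \<psi>]
    by (auto simp: divide_inverse nonzero_inverse_mult_distrib)
  moreover have "inverse r = \<psi> v / \<psi> u" "\<psi> u \<noteq> 0" using u assms(3) by auto
  ultimately show ?thesis unfolding has_value_at_def by blast
qed

text \<open>A density principle: agreement of values off the hypersurface p = 0 forces equality. It
  reduces identities in \<open>'d\<close> to computations with complex numbers.\<close>

lemma val_eqI:
  assumes p: "p \<in> Z0" "p \<noteq> 0"
    and v: "\<And>\<psi>. Z0_point \<psi> \<Longrightarrow> \<psi> p \<noteq> 0 \<Longrightarrow> \<exists>r. val w \<psi> r \<and> val w' \<psi> r"
  shows "w = w'"
proof -
  \<comment> \<open>One point off p = 0 serves to choose fractions representing both elements; their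
    denominators may vanish at other points.\<close>
  obtain \<psi>0 where \<psi>0: "Z0_point \<psi>0" "\<psi>0 p \<noteq> 0"
    using Z0_point_eqI[of p 0] p by (metis Z0_homD(2) Z0_point_def Z0_zero)
  obtain u v where u: "u \<in> Z0" "v \<in> Z0" "\<psi>0 v \<noteq> 0" "w = \<iota> u / \<iota> v"
    using assms(3)[OF \<psi>0] by (auto simp: has_value_at_def)
  obtain u' v' where u': "u' \<in> Z0" "v' \<in> Z0" "\<psi>0 v' \<noteq> 0" "w' = \<iota> u' / \<iota> v'"
    using assms(3)[OF \<psi>0] by (auto simp: has_value_at_def)
  have nz: "\<iota> v \<noteq> 0" "\<iota> v' \<noteq> 0" using u u' Z0_point_nonzero[OF \<psi>0(1)] by auto
  \<comment> \<open>Elsewhere only \<open>w * \<iota> v = \<iota> u\<close> and its analogue are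
    evaluated, so zeros of the denominators do no harm. The factor p takes care of the points where
    no common value is supplied.\<close>
  have "p * (u * v') = p * (u' * v)"
  proof (rule Z0_point_eqI)
    fix \<psi> assume \<psi>: "Z0_point \<psi>"
    note h = \<psi>[unfolded Z0_point_def, THEN conjunct1, THEN Z0_homD(4)]
    show "\<psi> (p * (u * v')) = \<psi> (p * (u' * v))"
    proof (cases "\<psi> p = 0")
      case False
      then obtain r where r: "val w \<psi> r" "val w' \<psi> r" using v \<psi> by blast
      have "w * \<iota> v = \<iota> u" "w' * \<iota> v' = \<iota> u'"
        using u u' nz by (simp_all only: division_ring_divide_mult_cancel not_False_eq_True)
      then have "r * \<psi> v = \<psi> u" "r * \<psi> v' = \<psi> u'"
        using val_mult[OF \<psi> r(1) val_\<iota>[OF \<psi>]] val_mult[OF \<psi> r(2) val_\<iota>[OF \<psi>]] u u'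
          val_unique[OF \<psi>] val_\<iota>[OF \<psi>] by metis+
      then have "\<psi> u * \<psi> v' = \<psi> u' * \<psi> v" by (simp flip: \<open>r * \<psi> v = \<psi> u\<close> \<open>r * \<psi> v' = \<psi> u'\<close>)
      then show ?thesis using u u' p by (simp add: h Z0_mult)
    qed (use u u' p in \<open>simp add: h Z0_mult\<close>)
  qed (use u u' p in auto)
  then have "u * v' = u' * v"
    using Z0_no_zero_divisors[of p "u * v' - u' * v"] u u' p
    by (simp add: right_diff_distrib Z0_mult Z0_diff)
  then have "\<iota> u * \<iota> v' = \<iota> u' * \<iota> v" using u u' by (metis \<iota>_simps(4))
  then show ?thesis using u u' nz \<iota>_commute[of v v'] by (simp add: division_ring_fraction_eq_iff)
qed

end

section \<open>The map $R$ on $N$-th powers\<close>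

locale weyl2_R = weyl2_fractions N \<iota> for N and \<iota> :: "weyl2 \<Rightarrow> 'd::division_ring" +
  fixes R :: "weyl2 \<Rightarrow> 'd"
  assumes RW: "is_RW (xi_root N) \<iota> R"
begin

lemma R_weyl2_hom: "is_weyl2_hom q R"
  using RW by (simp add: is_RW_def)

lemma R_hom: "Z0_hom R"
  by (rule Z0_hom_weyl2_hom[OF R_weyl2_hom])

lemmas R_simps = Z0_homD[OF R_hom]

lemma R_const: "R (weyl2_const c) = \<iota> (weyl2_const c)"
  using RW by (simp add: is_RW_def)

abbreviation r :: "weyl_exp \<times> weyl_exp \<Rightarrow> complex \<Rightarrow> 'd" where
  "r k c \<equiv> R (Poly_Mapping.single k c)"

lemma twist_eval:
  "weyl2_twist q ((i, j, k), (i', j', k')) ((a, b, c), (a', b', c'))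
     = q powi (- 2 * j * a) * q powi (- 2 * j' * a')"
  by (simp add: weyl2_twist_def weyl_twist_def)

lemma e_mult:
  "e ((i, j, k), (i', j', k')) s * e ((a, b, c), (a', b', c')) t
     = e ((i + a, j + b, k + c), (i' + a', j' + b', k' + c'))
         (q powi (- 2 * j * a) * q powi (- 2 * j' * a') * s * t)"
  by (simp add: e_simps twist_eval)

lemma e_one: "e ((0, 0, 0), (0, 0, 0)) 1 = 1"
  using weyl2_homD(1)[OF \<iota>_weyl2_hom] by (simp add: zero_prod_def)

lemma e_inverse_gen:
  "inverse (e ((1, 0, 0), (0, 0, 0)) 1) = e ((- 1, 0, 0), (0, 0, 0)) 1"
  "inverse (e ((0, 1, 0), (0, 0, 0)) 1) = e ((0, - 1, 0), (0, 0, 0)) 1"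
  "inverse (e ((0, 0, 0), (0, 1, 0)) 1) = e ((0, 0, 0), (0, - 1, 0)) 1"
  "inverse (e ((0, 0, 0), (1, 0, 0)) 1) = e ((0, 0, 0), (- 1, 0, 0)) 1"
  "inverse (e ((0, 0, 0), (0, 0, 1)) 1) = e ((0, 0, 0), (0, 0, - 1)) 1"
  by (rule inverse_unique, simp add: e_mult e_one)+

lemma R_gen:
  defines "g \<equiv> 1 - e ((- 1, 0, 0), (0, 0, 0)) 1 * e ((0, 1, 0), (0, 0, 0)) 1
      * (e ((0, 0, 1), (0, 0, 0)) 1 - e ((1, 0, 0), (0, 0, 0)) 1) * e ((0, 0, 0), (0, - 1, 0)) 1
      * (e ((0, 0, 0), (1, 0, 0)) 1 - e ((0, 0, 0), (0, 0, - 1)) 1)"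
  shows "r ((1, 0, 0), (0, 0, 0)) 1 = e ((1, 0, 0), (0, 0, 0)) 1 * g"
    and "r ((0, 0, 0), (1, 0, 0)) 1 = inverse g * e ((0, 0, 0), (1, 0, 0)) 1"
    and "r ((0, 0, 1), (0, 0, 0)) 1 = e ((0, 0, 1), (0, 0, 0)) 1"
    and "r ((0, 0, 0), (0, 0, 1)) 1 = e ((0, 0, 0), (0, 0, 1)) 1"
    and "r ((0, - 1, 0), (0, 0, 0)) 1 = e ((0, 0, 0), (0, - 1, 0)) 1
      + (e ((0, - 1, 0), (0, 0, 0)) 1 - e ((0, 0, 0), (0, 0, - 1)) 1 * e ((0, 0, 0), (0, - 1, 0)) 1)
        * e ((0, 0, 0), (- 1, 0, 0)) 1"
    and "r ((0, 0, 0), (0, 1, 0)) 1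
      = e ((0, 0, 1), (0, 0, 0)) 1 * e ((0, 0, 0), (0, 0, - 1)) 1 * e ((0, 1, 0), (0, 0, 0)) 1
        + (e ((0, 0, 0), (0, 1, 0)) 1 - e ((0, 0, 0), (0, 0, - 1)) 1 * e ((0, 1, 0), (0, 0, 0)) 1)
          * e ((1, 0, 0), (0, 0, 0)) 1"
  using RW unfolding is_RW_def Let_def tensor_one e_inverse_gen divide_inverse g_def by blast+

lemma q_power_N: "(inverse q ^ 2) ^ N = 1" "(q ^ 2) ^ N = 1" "(q ^ 2 * a) ^ N = a ^ N"
    "(inverse q ^ 2 * a) ^ N = a ^ N" "(- (q ^ 2)) ^ N = - sN" "(- (inverse q ^ 2)) ^ N = - sN"
proof -
  show *: "(q ^ 2) ^ N = 1" by (rule xi_root_powers(3)[OF N_ge_2])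
  then show **: "(inverse q ^ 2) ^ N = 1" by (simp add: power_inverse)
  show "(q ^ 2 * a) ^ N = a ^ N" "(inverse q ^ 2 * a) ^ N = a ^ N"
    unfolding power_mult_distrib * ** by simp_all
  show "(- (q ^ 2)) ^ N = - sN" "(- (inverse q ^ 2)) ^ N = - sN"
    unfolding power_minus[of "q ^ 2"] power_minus[of "inverse q ^ 2"] * ** by (simp_all add: sN)
qed

lemma q_powi: "q powi 2 = q ^ 2" "q powi (- 2) = inverse q ^ 2"
  by (simp_all add: power_int_minus power_inverse)

lemmas e_power_N = weyl2_hom_power_N[OF \<iota>_weyl2_hom]
lemmas r_power_N = weyl2_hom_power_N[OF R_weyl2_hom]

lemma R_zz: "R zz1 = \<iota> zz1" "R zz2 = \<iota> zz2"
  using arg_cong[OF R_gen(3), of "\<lambda>t. t ^ N"] arg_cong[OF R_gen(4), of "\<lambda>t. t ^ N"]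
  by (simp_all add: e_power_N r_power_N gen_defs)

lemma q_cancel: "q ^ 2 * inverse q ^ 2 = 1" "q ^ 2 * (inverse q ^ 2 * a) = a"
    "inverse q ^ 2 * (q ^ 2 * a) = a" "q ^ 2 * inverse q ^ 4 = inverse q ^ 2"
    "inverse q ^ 2 * q ^ 4 = q ^ 2" "q ^ 4 * inverse q ^ 2 = q ^ 2"
  by (simp_all add: power_inverse field_simps flip: power_add)

lemmas e_ring = right_diff_distrib left_diff_distrib distrib_left distrib_right e_mult q_powi
  weyl2_homD(6)[OF \<iota>_weyl2_hom] diff_conv_add_uminus add_ac mult_ac q_cancel zero_prod_def

lemma inverse_mult_distrib_commuting: "inverse (a * b) = inverse b * inverse (a :: 'd)"
  by (cases "a = 0 \<or> b = 0") (auto intro: nonzero_inverse_mult_distrib)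

lemma \<iota>_diff_single:
  "\<iota> (u - Poly_Mapping.single k c) = \<iota> u + e k (- c)"
  by (simp add: weyl2_homD(2)[OF \<iota>_weyl2_hom, symmetric] single_uminus)

lemmas e_power_N_simps = \<iota>_diff_single add.commute twist_eval q_powi q_cancel e_power_N q_power_N sN gen_defs mult_single
  right_diff_distrib

text \<open>In normal order x_1 g = U + V W, where V = y_1 (x_1 - z_1) and W = y_2^{-1} (x_2 -
  z_2^{-1}) lie in different tensor factors and commute. The collapse applies to V, to W and to the
  outer sum; V^N and W^N each carry the sign \<open>sN\<close>, and the two signs cancel.\<close>

lemma R_xx1: "R xx1 = \<iota> (xx1 + yy1 * (xx1 - zz1) * yy2i * (xx2 - zz2i))"
proof -
  define U where "U = e ((1, 0, 0), (0, 0, 0)) 1"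
  define V where "V = e ((1, 1, 0), (0, 0, 0)) (inverse q ^ 2) + e ((0, 1, 1), (0, 0, 0)) (- 1)"
  define W where "W = e ((0, 0, 0), (0, - 1, - 1)) (- 1) + e ((0, 0, 0), (1, - 1, 0)) (q ^ 2)"
  note UVW = U_def V_def W_def
  have V: "V ^ N = \<iota> (weyl2_const sN * yy1 * (xx1 - zz1))"
    unfolding V_def by (subst e_power_N_add) (simp_all add: e_power_N_simps)
  have W: "W ^ N = \<iota> (weyl2_const sN * yy2i * (xx2 - zz2i))"
    unfolding W_def by (subst e_power_N_add) (simp_all add: e_power_N_simps)
  have "R xx1 = r ((1, 0, 0), (0, 0, 0)) 1 ^ N"
    by (simp add: r_power_N gen_defs)
  also have "r ((1, 0, 0), (0, 0, 0)) 1 = U + V * W"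
    unfolding R_gen(1) UVW by (simp add: e_ring del: add_uminus_conv_diff)
  also have "(U + V * W) ^ N = U ^ N + (V * W) ^ N"
    by (rule power_N_add) (simp only: UVW e_ring, simp add: q_powi q_cancel add_ac)
  also have "(V * W) ^ N = V ^ N * W ^ N"
    by (rule power_mult_distrib_commuting) (simp add: UVW e_ring del: add_uminus_conv_diff)
  also have "U ^ N = \<iota> xx1" by (simp add: U_def e_power_N gen_defs)
  also have "\<iota> xx1 + V ^ N * W ^ N
      = \<iota> (xx1 + (weyl2_const sN * yy1 * (xx1 - zz1)) * (weyl2_const sN * yy2i * (xx2 - zz2i)))"
    unfolding V W by (simp add: \<iota>_simps Z0_mult Z0_diff Z0_add del: times_divide_eq_left)
  also have "(weyl2_const sN * yy1 * (xx1 - zz1)) * (weyl2_const sN * yy2i * (xx2 - zz2i))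
      = (weyl2_const sN * weyl2_const sN) * (yy1 * (xx1 - zz1) * yy2i * (xx2 - zz2i))"
    by (simp only: mult_ac)
  also have "weyl2_const sN * weyl2_const sN = 1" by (simp add: mult_single sN)
  finally show ?thesis by simp
qed

text \<open>Passing to x_2^{-1} replaces the inverse of g by g itself: the image x_2^{-1} g is again
  a sum U + V W of the kind treated for x_1 g.\<close>

lemma R_xx2i: "R xx2i = \<iota> (xx2i + yy1 * (1 - xx1i * zz1) * yy2i * (1 - xx2i * zz2i))"
proof -
  define U where "U = e ((0, 0, 0), (- 1, 0, 0)) 1"
  define V where "V = e ((0, 1, 0), (0, 0, 0)) (inverse q ^ 2) + e ((- 1, 1, 1), (0, 0, 0)) (- 1)"
  define W where "W = e ((0, 0, 0), (- 1, - 1, - 1)) (- 1) + e ((0, 0, 0), (0, - 1, 0)) (q ^ 2)"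
  note UVW = U_def V_def W_def
  have V: "V ^ N = \<iota> (yy1 * (1 - xx1i * zz1))"
    unfolding V_def by (subst e_power_N_add) (simp_all add: e_power_N_simps)
  have W: "W ^ N = \<iota> (yy2i * (1 - xx2i * zz2i))"
    unfolding W_def by (subst e_power_N_add) (simp_all add: e_power_N_simps)
  have "R xx2i = r ((0, 0, 0), (- 1, 0, 0)) 1 ^ N"
    by (simp add: r_power_N gen_defs)
  also have "r ((0, 0, 0), (- 1, 0, 0)) 1 = inverse (r ((0, 0, 0), (1, 0, 0)) 1)"
    by (rule inverse_unique[symmetric])
       (use weyl2_homD(1)[OF R_weyl2_hom] in
         \<open>simp add: weyl2_homD(7)[OF R_weyl2_hom] twist_eval zero_prod_def\<close>)
  also have "\<dots> = U + V * W"
    unfolding R_gen(2) inverse_mult_distrib_commuting inverse_inverse_eq e_inverse_gen UVW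
    by (simp add: e_ring del: add_uminus_conv_diff)
  also have "(U + V * W) ^ N = U ^ N + (V * W) ^ N"
    by (rule power_N_add) (simp only: UVW e_ring, simp add: q_powi q_cancel add_ac)
  also have "(V * W) ^ N = V ^ N * W ^ N"
    by (rule power_mult_distrib_commuting) (simp add: UVW e_ring del: add_uminus_conv_diff)
  also have "U ^ N = \<iota> xx2i" by (simp add: U_def e_power_N gen_defs)
  also have "\<iota> xx2i + V ^ N * W ^ N = \<iota> (xx2i + (yy1 * (1 - xx1i * zz1)) * (yy2i * (1 - xx2i * zz2i)))"
    unfolding V W by (simp add: \<iota>_simps Z0_mult Z0_diff Z0_add)
  finally show ?thesis by (simp only: mult.assoc)
qed

text \<open>The image of y_1^{-1} is Q + P with Q = y_1^{-1} x_2^{-1} and P = y_2^{-1} (1 - z_2^{-1}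
  x_2^{-1}); the collapse applies to P and then to Q + P.\<close>

lemma R_yy1i: "R yy1i = \<iota> (yy2i * (1 - xx2i * zz2i) + yy1i * xx2i)"
proof -
  define P where "P = e ((0, 0, 0), (- 1, - 1, - 1)) (- (inverse q ^ 2)) + e ((0, 0, 0), (0, - 1, 0)) 1"
  define Q where "Q = e ((0, - 1, 0), (- 1, 0, 0)) 1"
  have P: "P ^ N = \<iota> (yy2i * (1 - xx2i * zz2i))"
    unfolding P_def by (subst e_power_N_add) (simp_all add: e_power_N_simps)
  have "R yy1i = r ((0, - 1, 0), (0, 0, 0)) 1 ^ N"
    by (simp add: r_power_N gen_defs)
  also have "r ((0, - 1, 0), (0, 0, 0)) 1 = Q + P"
    unfolding R_gen(5) P_def Q_def by (simp add: e_ring del: add_uminus_conv_diff)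
  also have "(Q + P) ^ N = Q ^ N + P ^ N"
    by (rule power_N_add) (simp only: P_def Q_def e_ring, simp add: q_powi q_cancel add_ac)
  also have "Q ^ N = \<iota> (yy1i * xx2i)"
    by (simp add: Q_def e_power_N gen_defs mult_single)
  finally show ?thesis using P by (simp add: \<iota>_simps Z0_mult Z0_diff Z0_add add.commute)
qed

lemma R_yy2: "R yy2 = \<iota> (yy1 * zz2i * (zz1 - xx1) + yy2 * xx1)"
proof -
  define P where "P = e ((1, 1, 0), (0, 0, - 1)) (- (inverse q ^ 2)) + e ((0, 1, 1), (0, 0, - 1)) 1"
  define Q where "Q = e ((1, 0, 0), (0, 1, 0)) 1"
  have P: "P ^ N = \<iota> (yy1 * zz2i * (zz1 - xx1))"
    unfolding P_def by (subst e_power_N_add) (simp_all add: e_power_N_simps)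
  have "R yy2 = r ((0, 0, 0), (0, 1, 0)) 1 ^ N"
    by (simp add: r_power_N gen_defs)
  also have "r ((0, 0, 0), (0, 1, 0)) 1 = Q + P"
    unfolding R_gen(6) P_def Q_def by (simp add: e_ring del: add_uminus_conv_diff)
  also have "(Q + P) ^ N = Q ^ N + P ^ N"
    by (rule power_N_add) (simp only: P_def Q_def e_ring, simp add: q_powi q_cancel add_ac)
  also have "Q ^ N = \<iota> (yy2 * xx1)"
    by (simp add: Q_def e_power_N gen_defs mult_single)
  finally show ?thesis using P by (simp add: \<iota>_simps Z0_mult Z0_diff Z0_add add.commute)
qed

end

section \<open>The pullback and the braiding\<close>

text \<open>
  Here $\alpha_i, \beta_i$ are the coordinates of the pullback of the point $(a_i, b_i, m_i)$, and the
  identities invert the pullback.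
\<close>

lemma pullback_identities:
  fixes a1 b1 m1 a2 b2 m2 :: "'a::field"
  defines "n1 \<equiv> a1 * b2 * m2 + b1 * (a1 - m1) * (a2 * m2 - 1)"
    and "n2 \<equiv> b1 * (m1 - a1) + m2 * b2 * a1"
    and "n3 \<equiv> b1 * (a2 * m2 - 1) + b2 * m2"
  assumes nz: "a1 \<noteq> 0" "b1 \<noteq> 0" "m1 \<noteq> 0" "a2 \<noteq> 0" "b2 \<noteq> 0" "m2 \<noteq> 0" "n1 \<noteq> 0" "n2 \<noteq> 0" "n3 \<noteq> 0"
    and c: "\<alpha>1 = n1 / (b2 * m2)" "\<alpha>2 = a1 * a2 * b2 * m2 / n1"
       "\<beta>1 = b1 * b2 * a2 * m2 / n3" "\<beta>2 = n2 / m2"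
  shows "\<beta>2 * m2 * \<alpha>2 - \<beta>1 * (m1 - \<alpha>1) * (m2 * \<alpha>2 - 1) = a2 * n2"
    and "m2 * \<beta>2 * \<beta>1 = b1 * (m1 * \<beta>1 - m2 * \<alpha>2 * (m1 * \<beta>1 - \<beta>2))"
    and "\<alpha>1 * \<beta>1 - (m1 * \<beta>1 - \<beta>2) = b2 * \<alpha>1"
proof -
  have p: "\<alpha>1 * (b2 * m2) = n1" "\<alpha>2 * n1 = a1 * a2 * b2 * m2" "\<beta>1 * n3 = b1 * b2 * a2 * m2" "\<beta>2 * m2 = n2"
    using nz by (simp_all add: c)
  \<comment> \<open>This reflects that \<open>R\<close> fixes x_1 x_2, because the factors g and
    g^{-1} meet.\<close>
  have q: "\<alpha>1 * \<alpha>2 = a1 * a2" using nz by (simp add: c)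
  show "\<alpha>1 * \<beta>1 - (m1 * \<beta>1 - \<beta>2) = b2 * \<alpha>1"
  proof -
    have "n3 * m2 * (\<alpha>1 * \<beta>1 - (m1 * \<beta>1 - \<beta>2)) = n3 * m2 * (b2 * \<alpha>1)"
      using p q unfolding n1_def n2_def n3_def by algebra
    then show ?thesis using nz by simp
  qed
  show "m2 * \<beta>2 * \<beta>1 = b1 * (m1 * \<beta>1 - m2 * \<alpha>2 * (m1 * \<beta>1 - \<beta>2))"
  proof -
    have "n1 * n3 * (m2 * \<beta>2 * \<beta>1) = n1 * n3 * (b1 * (m1 * \<beta>1 - m2 * \<alpha>2 * (m1 * \<beta>1 - \<beta>2)))"
      using p q unfolding n1_def n2_def n3_def by algebra
    then show ?thesis using nz by simp
  qed
  show "\<beta>2 * m2 * \<alpha>2 - \<beta>1 * (m1 - \<alpha>1) * (m2 * \<alpha>2 - 1) = a2 * n2"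
  proof -
    \<comment> \<open>Both differences factor: n3 cancels the denominator of \<beta>1, and n2 is the
      numerator of \<beta>2, so the product becomes manageable.\<close>
    have 1: "m1 - \<alpha>1 = (m1 - a1) * n3 / (b2 * m2)" using nz by (simp add: c n1_def n3_def field_simps)
    have 2: "m2 * \<alpha>2 - 1 = (a2 * m2 - 1) * n2 / n1" using nz(1-6,8-) nz(7)
      by (simp add: c) (simp add: n1_def n2_def field_simps)
    have 3: "\<beta>1 * (m1 - \<alpha>1) * (m2 * \<alpha>2 - 1) = b1 * a2 * (m1 - a1) * (a2 * m2 - 1) * n2 / n1"
      unfolding 1 2 using nz by (simp add: c)
    have "\<beta>2 * m2 * \<alpha>2 = a1 * a2 * b2 * m2 * n2 / n1" using nz by (simp add: c)
    then have "\<beta>2 * m2 * \<alpha>2 - \<beta>1 * (m1 - \<alpha>1) * (m2 * \<alpha>2 - 1) = a2 * n1 * n2 / n1"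
      unfolding 3 by (simp add: n1_def algebra_simps flip: diff_divide_distrib)
    then show ?thesis using nz by simp
  qed
qed

text \<open>Here $\alpha_i, \beta_i$ are the coordinates produced by the braiding formulas.\<close>

lemma braiding_identities:
  fixes a1 b1 m1 a2 b2 m2 :: "'a::field"
  defines "n \<equiv> b2 * m2 * a2 - b1 * (m1 - a1) * (m2 * a2 - 1)"
    and "d \<equiv> m1 * b1 - m2 * a2 * (m1 * b1 - b2)"
    and "f \<equiv> a1 * b1 - (m1 * b1 - b2)"
  assumes nz: "a1 \<noteq> 0" "b1 \<noteq> 0" "m1 \<noteq> 0" "a2 \<noteq> 0" "b2 \<noteq> 0" "m2 \<noteq> 0" "n \<noteq> 0" "d \<noteq> 0" "f \<noteq> 0"
    and c: "\<alpha>1 = a1 * a2 * b2 * m2 / n" "\<alpha>2 = n / (b2 * m2)"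
       "\<beta>1 = m2 * b2 * b1 / d" "\<beta>2 = f / a1"
  shows "\<alpha>1 * \<beta>2 * m2 + \<beta>1 * (\<alpha>1 - m1) * (\<alpha>2 * m2 - 1) = a1 * \<beta>2 * m2"
    and "\<beta>1 * (\<alpha>2 * m2 - 1) + \<beta>2 * m2 = \<beta>1 * \<beta>2 * \<alpha>2 * m2 / b1"
    and "\<beta>1 * (m1 - \<alpha>1) + m2 * \<beta>2 * \<alpha>1 = m2 * b2"
proof -
  \<comment> \<open>The same kind of factorization as for the pullback: d is the denominator of
    \<beta>1 and f the numerator of \<beta>2.\<close>
  have 1: "\<alpha>1 - m1 = (a1 - m1) * d / n" using nz(1-6,8-) nz(7)
    by (simp add: c divide_simps) (simp add: n_def d_def algebra_simps)
  have 2: "\<alpha>2 * m2 - 1 = (a2 * m2 - 1) * f / b2" using nz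
    by (simp add: c divide_simps) (simp add: n_def f_def algebra_simps)
  have 3: "\<beta>1 * (\<alpha>1 - m1) = m2 * b2 * b1 * (a1 - m1) / n"
    unfolding 1 using nz by (simp add: c)
  have 4: "\<beta>1 * (\<alpha>1 - m1) * (\<alpha>2 * m2 - 1) = m2 * b1 * (a1 - m1) * (a2 * m2 - 1) * f / n"
    unfolding 3 2 using nz by simp
  show "\<alpha>1 * \<beta>2 * m2 + \<beta>1 * (\<alpha>1 - m1) * (\<alpha>2 * m2 - 1) = a1 * \<beta>2 * m2"
    unfolding 4 using nz by (simp add: c divide_simps) (simp add: n_def algebra_simps)
  show "\<beta>1 * (\<alpha>2 * m2 - 1) + \<beta>2 * m2 = \<beta>1 * \<beta>2 * \<alpha>2 * m2 / b1"
    unfolding 2 using nz by (simp add: c divide_simps) (simp add: n_def d_def algebra_simps)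
  show "\<beta>1 * (m1 - \<alpha>1) + m2 * \<beta>2 * \<alpha>1 = m2 * b2"
  proof -
    have "\<beta>1 * (m1 - \<alpha>1) = - (m2 * b2 * b1 * (a1 - m1) / n)"
      using 3 by (simp only: minus_mult_right[symmetric] minus_diff_eq[of \<alpha>1 m1, symmetric])
    moreover have "m2 * \<beta>2 * \<alpha>1 = m2 * b2 * (m2 * a2 * f) / n" using nz by (simp add: c)
    ultimately have "\<beta>1 * (m1 - \<alpha>1) + m2 * \<beta>2 * \<alpha>1
        = (m2 * b2 * (m2 * a2 * f) - m2 * b2 * b1 * (a1 - m1)) / n"
      by (simp only: diff_divide_distrib) simp
    also have "m2 * b2 * (m2 * a2 * f) - m2 * b2 * b1 * (a1 - m1) = m2 * b2 * n"
      by (simp add: n_def f_def algebra_simps)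
    finally show ?thesis using nz by simp
  qed
qed

context root_of_unity_index
begin

lemmas Z0_closed = Z0_add Z0_mult Z0_diff

lemma Z0_pointD:
  assumes "Z0_point \<psi>"
  shows "\<psi> 1 = 1" "\<psi> 0 = 0" "\<psi> (weyl2_const c) = c"
    and "u \<in> Z0 \<Longrightarrow> v \<in> Z0 \<Longrightarrow> \<psi> (u + v) = \<psi> u + \<psi> v"
    and "u \<in> Z0 \<Longrightarrow> v \<in> Z0 \<Longrightarrow> \<psi> (u * v) = \<psi> u * \<psi> v"
    and "u \<in> Z0 \<Longrightarrow> v \<in> Z0 \<Longrightarrow> \<psi> (u - v) = \<psi> u - \<psi> v"
  using assms Z0_homD[of \<psi>] by (auto simp: Z0_point_def)

text \<open>These are the images under \<open>R\<close> of \<open>xx1\<close>, \<open>xx2i\<close>, \<open>yy1i\<close> and \<open>yy2\<close>.\<close>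

definition "im_xx1 = xx1 + yy1 * (xx1 - zz1) * yy2i * (xx2 - zz2i)"
definition "im_xx2i = xx2i + yy1 * (1 - xx1i * zz1) * yy2i * (1 - xx2i * zz2i)"
definition "im_yy1i = yy2i * (1 - xx2i * zz2i) + yy1i * xx2i"
definition "im_yy2 = yy1 * zz2i * (zz1 - xx1) + yy2 * xx1"

lemmas im_defs = im_xx1_def im_xx2i_def im_yy1i_def im_yy2_def

lemma im_Z0 [simp]: "im_xx1 \<in> Z0" "im_xx2i \<in> Z0" "im_yy1i \<in> Z0" "im_yy2 \<in> Z0"
  by (simp_all add: im_defs Z0_closed)

text \<open>\<open>\<psi>'\<close> is the pullback of \<open>\<psi>\<close> along \<open>R\<close>.\<close>

definition R_related :: "(weyl2 \<Rightarrow> complex) \<Rightarrow> (weyl2 \<Rightarrow> complex) \<Rightarrow> bool" where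
  "R_related \<psi> \<psi>' \<longleftrightarrow> Z0_point \<psi> \<and> Z0_point \<psi>' \<and>
     \<psi>' xx1 = \<psi> im_xx1 \<and> \<psi>' xx2i = \<psi> im_xx2i \<and> \<psi>' yy1i = \<psi> im_yy1i \<and> \<psi>' yy2 = \<psi> im_yy2 \<and>
     \<psi>' zz1 = \<psi> zz1 \<and> \<psi>' zz2 = \<psi> zz2"

text \<open>Where this product is nonzero, the pulled back coordinates are nonzero and finite, so
  the pullback is again a point of the torus.\<close>

definition "R_generic = im_xx1 * im_xx2i * im_yy1i * im_yy2"

text \<open>A witness that the genericity polynomials are nonzero: at this point every difference
  such as \<open>xx1 - zz1\<close> vanishes and each of their factors takes the value 1.\<close>

lemma all_ones_point:
  obtains \<psi> where "Z0_point \<psi>" "\<psi> xx1 = 1" "\<psi> yy1 = 1" "\<psi> zz1 = 1"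
    "\<psi> xx2 = 1" "\<psi> yy2 = 1" "\<psi> zz2 = 1"
  by (rule Z0_point_exists[of 1 1 1 1 1 1]) simp_all

lemma R_generic: "R_generic \<in> Z0" "R_generic \<noteq> 0"
proof -
  show "R_generic \<in> Z0" by (simp add: R_generic_def Z0_closed)
  obtain \<psi> where \<psi>: "Z0_point \<psi>" "\<psi> xx1 = 1" "\<psi> yy1 = 1" "\<psi> zz1 = 1"
    "\<psi> xx2 = 1" "\<psi> yy2 = 1" "\<psi> zz2 = 1" by (rule all_ones_point)
  have "\<psi> R_generic = 1"
    by (simp add: R_generic_def im_defs Z0_pointD[OF \<psi>(1)] Z0_point_gen[OF \<psi>(1)] Z0_closed \<psi>)
  then show "R_generic \<noteq> 0" using Z0_pointD(2)[OF \<psi>(1)] by auto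
qed

lemma R_related_exists:
  assumes \<psi>: "Z0_point \<psi>" "\<psi> R_generic \<noteq> 0"
  obtains \<psi>' where "R_related \<psi> \<psi>'"
proof -
  have nz: "\<psi> im_xx1 \<noteq> 0" "\<psi> im_xx2i \<noteq> 0" "\<psi> im_yy1i \<noteq> 0" "\<psi> im_yy2 \<noteq> 0"
    using \<psi>(2) by (auto simp: R_generic_def Z0_pointD[OF \<psi>(1)] Z0_closed)
  obtain \<psi>' where \<psi>': "Z0_point \<psi>'" "\<psi>' xx1 = \<psi> im_xx1" "\<psi>' yy1 = inverse (\<psi> im_yy1i)"
      "\<psi>' zz1 = \<psi> zz1" "\<psi>' xx2 = inverse (\<psi> im_xx2i)" "\<psi>' yy2 = \<psi> im_yy2" "\<psi>' zz2 = \<psi> zz2"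
    using nz Z0_point_gen[OF \<psi>(1)]
    by (auto intro: Z0_point_exists[of "\<psi> im_xx1" "inverse (\<psi> im_yy1i)" "\<psi> zz1"
          "inverse (\<psi> im_xx2i)" "\<psi> im_yy2" "\<psi> zz2"])
  then have "R_related \<psi> \<psi>'"
    unfolding R_related_def using \<psi>(1) by (simp add: Z0_point_gen)
  then show ?thesis using that by blast
qed

lemma im_eval:
  assumes "Z0_point \<psi>"
  defines "n1 \<equiv> \<psi> xx1 * \<psi> yy2 * \<psi> zz2 + \<psi> yy1 * (\<psi> xx1 - \<psi> zz1) * (\<psi> xx2 * \<psi> zz2 - 1)"
  shows "\<psi> im_xx1 = n1 / (\<psi> yy2 * \<psi> zz2)"
    and "\<psi> im_xx2i = n1 / (\<psi> xx1 * \<psi> xx2 * \<psi> yy2 * \<psi> zz2)"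
    and "\<psi> im_yy1i = (\<psi> yy1 * (\<psi> xx2 * \<psi> zz2 - 1) + \<psi> yy2 * \<psi> zz2)
           / (\<psi> yy1 * \<psi> yy2 * \<psi> xx2 * \<psi> zz2)"
    and "\<psi> im_yy2 = (\<psi> yy1 * (\<psi> zz1 - \<psi> xx1) + \<psi> zz2 * \<psi> yy2 * \<psi> xx1) / \<psi> zz2"
  using Z0_point_gen(7-)[OF assms(1)]
  by (simp_all add: im_defs Z0_pointD[OF assms(1)] Z0_point_gen(1-6)[OF assms(1)] Z0_closed n1_def
      field_simps)

text \<open>
  After clearing denominators, $A$ is \<open>num_A\<close>$/(m_2 a_2 b_2)$, while $b_{1'}$ has denominator \<open>den_b1\<close>
  and $b_{2'}$ is \<open>num_b2\<close>$/a_1$.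
\<close>

definition "num_A = yy2 * zz2 * xx2 - yy1 * (zz1 - xx1) * (zz2 * xx2 - 1)"
definition "den_b1 = zz1 * yy1 - zz2 * xx2 * (zz1 * yy1 - yy2)"
definition "num_b2 = xx1 * yy1 - (zz1 * yy1 - yy2)"

lemmas num_defs = num_A_def den_b1_def num_b2_def

lemma num_Z0 [simp]: "num_A \<in> Z0" "den_b1 \<in> Z0" "num_b2 \<in> Z0"
  by (simp_all add: num_defs Z0_closed)

text \<open>Each equation has the form \<psi>' P = (\<psi> u)(\<psi>' Q), the pointwise version of
  \<open>R P = \<iota> u * R Q\<close>. The fractions P / Q are the right-hand sides of the braiding
  formulas.\<close>

lemma inverse_formulas:
  assumes "R_related \<psi> \<psi>'"
  shows "\<psi>' (xx1 * xx2 * yy2 * zz2) = \<psi> xx1 * \<psi>' num_A"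
    and "\<psi>' num_A = \<psi> xx2 * \<psi>' (yy2 * zz2)"
    and "\<psi>' (zz2 * yy2 * yy1) = \<psi> yy1 * \<psi>' den_b1"
    and "\<psi>' num_b2 = \<psi> yy2 * \<psi>' xx1"
proof -
  have p: "Z0_point \<psi>" "Z0_point \<psi>'" and z: "\<psi>' zz1 = \<psi> zz1" "\<psi>' zz2 = \<psi> zz2"
    using assms by (auto simp: R_related_def)
  note nz = Z0_point_gen(7-)[OF p(1)] and nz' = Z0_point_gen(7-)[OF p(2)]
  let ?n1 = "\<psi> xx1 * \<psi> yy2 * \<psi> zz2 + \<psi> yy1 * (\<psi> xx1 - \<psi> zz1) * (\<psi> xx2 * \<psi> zz2 - 1)"
  let ?n2 = "\<psi> yy1 * (\<psi> zz1 - \<psi> xx1) + \<psi> zz2 * \<psi> yy2 * \<psi> xx1"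
  let ?n3 = "\<psi> yy1 * (\<psi> xx2 * \<psi> zz2 - 1) + \<psi> yy2 * \<psi> zz2"
  have x1: "\<psi>' xx1 = ?n1 / (\<psi> yy2 * \<psi> zz2)"
    and x2: "inverse (\<psi>' xx2) = ?n1 / (\<psi> xx1 * \<psi> xx2 * \<psi> yy2 * \<psi> zz2)"
    and y1: "inverse (\<psi>' yy1) = ?n3 / (\<psi> yy1 * \<psi> yy2 * \<psi> xx2 * \<psi> zz2)"
    and y2: "\<psi>' yy2 = ?n2 / \<psi> zz2"
    using assms unfolding R_related_def Z0_point_gen(2,4)[OF p(2)] im_eval[OF p(1)] by blast+
  have n: "?n1 \<noteq> 0" "?n2 \<noteq> 0" "?n3 \<noteq> 0" using x1 y1 y2 nz' by auto
  have x2': "\<psi>' xx2 = \<psi> xx1 * \<psi> xx2 * \<psi> yy2 * \<psi> zz2 / ?n1"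
    and y1': "\<psi>' yy1 = \<psi> yy1 * \<psi> yy2 * \<psi> xx2 * \<psi> zz2 / ?n3"
    using arg_cong[OF x2, of inverse] arg_cong[OF y1, of inverse] by simp_all
  note id = pullback_identities[OF nz(1-6) n x1 x2' y1' y2]
  note eval = Z0_pointD[OF p(2)] Z0_closed num_defs z
  show A: "\<psi>' num_A = \<psi> xx2 * \<psi>' (yy2 * zz2)"
    using id(1) y2 nz by (simp add: eval)
  have "\<psi>' xx1 * \<psi>' xx2 = \<psi> xx1 * \<psi> xx2" using n(1) nz by (simp add: x1 x2')
  then show "\<psi>' (xx1 * xx2 * yy2 * zz2) = \<psi> xx1 * \<psi>' num_A"
    unfolding A by (simp add: eval)
  show "\<psi>' (zz2 * yy2 * yy1) = \<psi> yy1 * \<psi>' den_b1"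
    using id(2) by (simp add: eval)
  show "\<psi>' num_b2 = \<psi> yy2 * \<psi>' xx1"
    using id(3) by (simp add: eval)
qed

text \<open>Besides the two denominators it contains \<open>num_b2\<close>, since the point produced
  by the braiding formulas must have a nonzero coordinate b_{2'}.\<close>

definition "braiding_generic = num_A * den_b1 * num_b2"

lemma braiding_generic: "braiding_generic \<in> Z0" "braiding_generic \<noteq> 0"
proof -
  show "braiding_generic \<in> Z0" by (simp add: braiding_generic_def Z0_closed)
  obtain \<psi> where \<psi>: "Z0_point \<psi>" "\<psi> xx1 = 1" "\<psi> yy1 = 1" "\<psi> zz1 = 1"
    "\<psi> xx2 = 1" "\<psi> yy2 = 1" "\<psi> zz2 = 1" by (rule all_ones_point)
  have "\<psi> braiding_generic = 1"
    by (simp add: braiding_generic_def num_defs Z0_pointD[OF \<psi>(1)] Z0_closed \<psi>)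
  then show "braiding_generic \<noteq> 0" using Z0_pointD(2)[OF \<psi>(1)] by auto
qed

text \<open>The preimage is the point whose coordinates are the braiding formulas evaluated at
  \<psi>'; \<open>braiding_identities\<close> confirms that pulling it back returns \<psi>'.\<close>

lemma R_related_preimage:
  assumes \<psi>': "Z0_point \<psi>'" "\<psi>' braiding_generic \<noteq> 0"
  obtains \<psi> where "R_related \<psi> \<psi>'"
proof -
  note nz = Z0_point_gen(7-)[OF \<psi>'(1)]
  let ?n = "\<psi>' yy2 * \<psi>' zz2 * \<psi>' xx2 - \<psi>' yy1 * (\<psi>' zz1 - \<psi>' xx1) * (\<psi>' zz2 * \<psi>' xx2 - 1)"
  let ?d = "\<psi>' zz1 * \<psi>' yy1 - \<psi>' zz2 * \<psi>' xx2 * (\<psi>' zz1 * \<psi>' yy1 - \<psi>' yy2)"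
  let ?f = "\<psi>' xx1 * \<psi>' yy1 - (\<psi>' zz1 * \<psi>' yy1 - \<psi>' yy2)"
  have n: "?n \<noteq> 0" "?d \<noteq> 0" "?f \<noteq> 0"
    using \<psi>'(2) by (auto simp: braiding_generic_def num_defs Z0_pointD[OF \<psi>'(1)] Z0_closed)
  obtain \<psi> where \<psi>: "Z0_point \<psi>"
    and x1: "\<psi> xx1 = \<psi>' xx1 * \<psi>' xx2 * \<psi>' yy2 * \<psi>' zz2 / ?n"
    and y1: "\<psi> yy1 = \<psi>' zz2 * \<psi>' yy2 * \<psi>' yy1 / ?d" and z1: "\<psi> zz1 = \<psi>' zz1"
    and x2: "\<psi> xx2 = ?n / (\<psi>' yy2 * \<psi>' zz2)" and y2: "\<psi> yy2 = ?f / \<psi>' xx1"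
    and z2: "\<psi> zz2 = \<psi>' zz2"
    by (rule Z0_point_exists[of "\<psi>' xx1 * \<psi>' xx2 * \<psi>' yy2 * \<psi>' zz2 / ?n"
          "\<psi>' zz2 * \<psi>' yy2 * \<psi>' yy1 / ?d" "\<psi>' zz1" "?n / (\<psi>' yy2 * \<psi>' zz2)" "?f / \<psi>' xx1" "\<psi>' zz2"])
       (use n nz in auto)
  note nz\<psi> = Z0_point_gen(7-)[OF \<psi>]
  note id = braiding_identities[OF nz n x1 x2 y1 y2]
  note im = im_eval[OF \<psi>, unfolded z1 z2]
  have x: "\<psi> xx1 * \<psi> xx2 = \<psi>' xx1 * \<psi>' xx2" using n(1) nz by (simp add: x1 x2)
  have "\<psi> im_xx1 = \<psi>' xx1"
    unfolding im id(1) using nz nz\<psi> by simp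
  moreover have "\<psi> im_xx2i = inverse (\<psi>' xx2)"
    unfolding im id(1) x using nz nz\<psi> by (simp add: field_simps)
  moreover have "\<psi> im_yy1i = inverse (\<psi>' yy1)"
    unfolding im id(2) using nz nz\<psi> by (simp add: field_simps)
  moreover have "\<psi> im_yy2 = \<psi>' yy2"
    unfolding im id(3) using nz by simp
  ultimately have "R_related \<psi> \<psi>'"
    unfolding R_related_def using \<psi> \<psi>'(1) z1 z2 by (simp add: Z0_point_gen(1-6))
  then show ?thesis by (rule that)
qed

end

section \<open>Injectivity of \<open>R\<close>, its extension to fractions and the inverse\<close>

context weyl2_R
begin

text \<open>\<open>R_related\<close> fixes one of each generator and its inverse, namely the one
  with an explicit image; the other follows by inverting a nonzero value.\<close>

lemma val_R:
  assumes "R_related \<psi> \<psi>'" "u \<in> Z0"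
  shows "val (R u) \<psi> (\<psi>' u)"
proof -
  have p: "Z0_point \<psi>" "Z0_point \<psi>'" using assms(1) by (auto simp: R_related_def)
  have inv: "R v = inverse (R u)" "\<psi>' v = inverse (\<psi>' u)" "\<psi>' u \<noteq> 0"
    if "u * v = 1" "u \<in> Z0" "v \<in> Z0" for u v
  proof -
    have "R u * R v = 1" "\<psi>' u * \<psi>' v = 1"
      using that R_simps(1,4) Z0_pointD(1,5)[OF p(2)] by metis+
    then show "R v = inverse (R u)" "\<psi>' v = inverse (\<psi>' u)" "\<psi>' u \<noteq> 0"
      using inverse_unique by (metis, metis, auto)
  qed
  have step: "val (R v) \<psi> (\<psi>' v)" if "val (R u) \<psi> (\<psi>' u)" "u * v = 1" "u \<in> Z0" "v \<in> Z0" for u v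
    using inv[OF that(2-)] val_inverse[OF p(1) that(1)] by simp
  have "val (R xx1) \<psi> (\<psi>' xx1)" "val (R xx2i) \<psi> (\<psi>' xx2i)" "val (R yy1i) \<psi> (\<psi>' yy1i)"
    "val (R yy2) \<psi> (\<psi>' yy2)" "val (R zz1) \<psi> (\<psi>' zz1)" "val (R zz2) \<psi> (\<psi>' zz2)"
    unfolding R_xx1 R_xx2i R_yy1i R_yy2 R_zz im_defs[symmetric]
    using assms(1) val_\<iota>[OF p(1)] by (metis R_related_def im_Z0 gen_Z0)+
  note gens = this this[THEN step]
  from assms(2) show ?thesis
  proof (induction u rule: Z0_induct)
    case (const c)
    show ?case using val_\<iota>[OF p(1) Z0_const[of c]] by (simp add: R_const Z0_pointD p)
  next
    case (gen u)
    then show ?case using gens gen_inverse by (auto simp: mult.commute)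
  next
    case (add u v)
    then show ?case by (simp add: R_simps Z0_pointD[OF p(2)] val_add[OF p(1)])
  next
    case (mult u v)
    then show ?case by (simp add: R_simps Z0_pointD[OF p(2)] val_mult[OF p(1)])
  qed
qed

text \<open>\<open>R\<close> is injective on \<open>Z0\<close> because the pullback is dominant: almost every point is in its image.\<close>

lemma R_eq_0:
  assumes "u \<in> Z0" "R u = 0"
  shows "u = 0"
proof -
  \<comment> \<open>The extra factor disposes of the points for which no preimage has been
    constructed.\<close>
  have "braiding_generic * u = 0"
  proof (rule Z0_point_eqI)
    fix \<psi>' assume p': "Z0_point \<psi>'"
    show "\<psi>' (braiding_generic * u) = \<psi>' 0"
    proof (cases "\<psi>' braiding_generic = 0")
      case False
      then obtain \<psi> where rel: "R_related \<psi> \<psi>'" using R_related_preimage p' by blast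
      then have p: "Z0_point \<psi>" by (simp add: R_related_def)
      have "val (R u) \<psi> 0"
        using val_\<iota>[OF p Z0_zero] by (simp add: assms(2) \<iota>_simps Z0_pointD[OF p])
      then have "\<psi>' u = 0" using val_unique[OF p val_R[OF rel assms(1)]] by simp
      then show ?thesis using assms(1) braiding_generic(1) by (simp add: Z0_pointD[OF p'])
    qed (use assms(1) braiding_generic(1) in \<open>simp add: Z0_pointD[OF p']\<close>)
  qed (use assms(1) braiding_generic(1) in auto)
  then show ?thesis using Z0_no_zero_divisors[OF braiding_generic(1) assms(1)] braiding_generic(2) by simp
qed

text \<open>The description operator has a unique solution because injectivity keeps
  \<open>R v\<close> nonzero for every admissible denominator, so cross multiplication carries over
  from \<open>\<iota>\<close> to \<open>R\<close>.\<close>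

lemma RW_on_fractions_eq:
  assumes "u \<in> Z0" "v \<in> Z0" "v \<noteq> 0"
  shows "RW_on_fractions N \<iota> R (\<iota> u / \<iota> v) = R u / R v"
  unfolding RW_on_fractions_def
proof (rule the_equality)
  show "\<exists>u'\<in>Z0. \<exists>v'\<in>Z0. v' \<noteq> 0 \<and> \<iota> u / \<iota> v = \<iota> u' / \<iota> v' \<and> R u / R v = R u' / R v'"
    using assms by blast
next
  fix r assume "\<exists>u'\<in>Z0. \<exists>v'\<in>Z0. v' \<noteq> 0 \<and> \<iota> u / \<iota> v = \<iota> u' / \<iota> v' \<and> r = R u' / R v'"
  then obtain u' v' where u': "u' \<in> Z0" "v' \<in> Z0" "v' \<noteq> 0" "\<iota> u / \<iota> v = \<iota> u' / \<iota> v'" "r = R u' / R v'"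
    by blast
  have "\<iota> u * \<iota> v' = \<iota> u' * \<iota> v"
    using u'(4) division_ring_fraction_eq_iff[of "\<iota> v" "\<iota> v'"] \<iota>_commute[of v v'] assms u' by simp
  then have "u * v' = u' * v" using assms u' by (simp add: \<iota>_inj flip: \<iota>_simps(4))
  then have "R u * R v' = R u' * R v" using assms u' by (metis R_simps(4))
  moreover have "R v \<noteq> 0" "R v' \<noteq> 0" using R_eq_0 assms u' by blast+
  ultimately show "r = R u / R v"
    using division_ring_fraction_eq_iff[of "R v" "R v'" "R u" "R u'"] Z0_hom_commute[OF R_hom, of v v']
      assms u' by simp
qed

lemma RW_on_fractions_inj: "inj_on (RW_on_fractions N \<iota> R) (Z0_fractions N \<iota>)"
proof (rule inj_onI)
  fix w w' assume "w \<in> Z0_fractions N \<iota>" "w' \<in> Z0_fractions N \<iota>"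
    and eq: "RW_on_fractions N \<iota> R w = RW_on_fractions N \<iota> R w'"
  then obtain u v u' v' where u: "u \<in> Z0" "v \<in> Z0" "v \<noteq> 0" "w = \<iota> u / \<iota> v"
      "u' \<in> Z0" "v' \<in> Z0" "v' \<noteq> 0" "w' = \<iota> u' / \<iota> v'"
    unfolding Z0_fractions_def by blast
  have "R v \<noteq> 0" "R v' \<noteq> 0" using R_eq_0 u by blast+
  then have "R u * R v' = R u' * R v"
    using eq u division_ring_fraction_eq_iff[of "R v" "R v'" "R u" "R u'"]
      Z0_hom_commute[OF R_hom, of v v'] by (simp add: RW_on_fractions_eq)
  then have "R (u * v' - u' * v) = 0" using u by (simp add: R_simps Z0_closed)
  then have "u * v' - u' * v = 0" using u by (intro R_eq_0) (auto intro!: Z0_closed)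
  then have "\<iota> u * \<iota> v' = \<iota> u' * \<iota> v" using u by (metis \<iota>_simps(4) eq_iff_diff_eq_0)
  then show "w = w'"
    using u division_ring_fraction_eq_iff[of "\<iota> v" "\<iota> v'"] \<iota>_commute[of v v'] by simp
qed

text \<open>The equation exhibits P / Q as a preimage of \<open>\<iota> u\<close>, and injectivity
  on fractions makes \<open>inv_into\<close> return exactly this one.\<close>

lemma RW_inverse_eq:
  assumes "P \<in> Z0" "Q \<in> Z0" "Q \<noteq> 0" "R P = \<iota> u * R Q"
  shows "RW_inverse N \<iota> R (\<iota> u) = \<iota> P / \<iota> Q"
  unfolding RW_inverse_def
proof (rule inv_into_f_eq[OF RW_on_fractions_inj])
  show "\<iota> P / \<iota> Q \<in> Z0_fractions N \<iota>" using assms unfolding Z0_fractions_def by blast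
  have "R Q \<noteq> 0" using R_eq_0 assms by blast
  then have "\<iota> u = R P / R Q" using assms(4) by (intro division_ring_eq_divideI) simp_all
  then show "RW_on_fractions N \<iota> R (\<iota> P / \<iota> Q) = \<iota> u"
    using assms by (simp add: RW_on_fractions_eq)
qed

text \<open>Transfers an identity between coordinates of a point and of its pullback to
  \<open>'d\<close>. Points off \<open>R_generic\<close> = 0 have a pullback, and these suffice by
  density.\<close>

lemma R_equationI:
  assumes "P \<in> Z0" "Q \<in> Z0" "u \<in> Z0" "\<And>\<psi> \<psi>'. R_related \<psi> \<psi>' \<Longrightarrow> \<psi>' P = \<psi> u * \<psi>' Q"
  shows "R P = \<iota> u * R Q"
proof (rule val_eqI[OF R_generic])
  fix \<psi> assume p: "Z0_point \<psi>" "\<psi> R_generic \<noteq> 0"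
  then obtain \<psi>' where rel: "R_related \<psi> \<psi>'" by (rule R_related_exists)
  have "val (R P) \<psi> (\<psi>' P)" "val (\<iota> u * R Q) \<psi> (\<psi> u * \<psi>' Q)"
    using val_R[OF rel] val_mult[OF p(1) val_\<iota>[OF p(1)]] assms(1-3) by blast+
  then show "\<exists>r. val (R P) \<psi> r \<and> val (\<iota> u * R Q) \<psi> r" using assms(4)[OF rel] by auto
qed

lemma R_equations:
  "R (xx1 * xx2 * yy2 * zz2) = \<iota> xx1 * R num_A"
  "R num_A = \<iota> xx2 * R (yy2 * zz2)"
  "R (zz2 * yy2 * yy1) = \<iota> yy1 * R den_b1"
  "R num_b2 = \<iota> yy2 * R xx1"
  "R zz1 = \<iota> zz1 * R 1" "R zz2 = \<iota> zz2 * R 1"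
  by (intro R_equationI inverse_formulas; simp add: Z0_closed)+ (simp_all add: R_zz R_simps)

lemma value_RW_inverse_imp:
  assumes "Z0_point \<psi>" "P \<in> Z0" "Q \<in> Z0" "\<psi> Q \<noteq> 0" "R P = \<iota> u * R Q"
    and "val (RW_inverse N \<iota> R (\<iota> u)) \<psi> s"
  shows "s = \<psi> P / \<psi> Q"
proof -
  have "Q \<noteq> 0" using assms(4) Z0_pointD(2)[OF assms(1)] by auto
  then have "val (RW_inverse N \<iota> R (\<iota> u)) \<psi> (\<psi> P / \<psi> Q)"
    using RW_inverse_eq[OF assms(2,3) _ assms(5)] assms(2-4) unfolding has_value_at_def by blast
  then show ?thesis using val_unique[OF assms(1,6)] by blast
qed

lemma value_RW_inverse:
  assumes \<psi>: "Z0_point \<psi>" and \<psi>': "Z0_point \<psi>'" and "\<psi> den_b1 \<noteq> 0" "\<psi> num_A \<noteq> 0"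
    and coords: "\<psi>' xx1 = \<psi> (xx1 * xx2 * yy2 * zz2) / \<psi> num_A" "\<psi>' xx2 = \<psi> num_A / \<psi> (yy2 * zz2)"
      "\<psi>' yy1 = \<psi> (zz2 * yy2 * yy1) / \<psi> den_b1" "\<psi>' yy2 = \<psi> num_b2 / \<psi> xx1"
      "\<psi>' zz1 = \<psi> zz1" "\<psi>' zz2 = \<psi> zz2"
    and "u \<in> Z0"
  shows "val (RW_inverse N \<iota> R (\<iota> u)) \<psi> (\<psi>' u)"
proof -
  \<comment> \<open>The inverse of \<open>R\<close> sends u to P / Q, which is regular at \<psi>
    with value \<psi>' u. Carrying P and Q along makes the property stable under sums and
    products.\<close>
  define fraction where "fraction u P Q \<longleftrightarrow>
      P \<in> Z0 \<and> Q \<in> Z0 \<and> \<psi> Q \<noteq> 0 \<and> R P = \<iota> u * R Q \<and> \<psi>' u = \<psi> P / \<psi> Q" for u P Q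
  note nz = Z0_point_gen(7-)[OF \<psi>] and nz' = Z0_point_gen(7-)[OF \<psi>']
  have one: "R 1 = 1" "\<psi> 1 = 1" by (simp_all add: R_simps Z0_pointD[OF \<psi>])
  have gens: "fraction xx1 (xx1 * xx2 * yy2 * zz2) num_A" "fraction xx2 num_A (yy2 * zz2)"
    "fraction yy1 (zz2 * yy2 * yy1) den_b1" "fraction yy2 num_b2 xx1"
    "fraction zz1 zz1 1" "fraction zz2 zz2 1"
    unfolding fraction_def using assms(3,4) coords R_equations nz one
    by (simp_all add: Z0_closed Z0_pointD(5)[OF \<psi>])
  \<comment> \<open>Inverting a generator swaps P and Q. The new denominator is nonzero at \<psi>
    because \<psi>' u is invertible; in particular \<open>num_b2\<close> is nonzero at \<psi> since
    \<psi>' is a torus point.\<close>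
  have inv: "fraction v Q P" if "fraction u P Q" "u * v = 1" "u \<in> Z0" "v \<in> Z0" for u v P Q
  proof -
    have 1: "\<psi>' u * \<psi>' v = 1" using that Z0_pointD(1,5)[OF \<psi>'] by metis
    have 2: "\<iota> v * \<iota> u = 1" using that \<iota>_simps(1,4) by (metis mult.commute)
    have "\<iota> v * R P = R Q"
      using that(1) 2 unfolding fraction_def by (metis mult.assoc mult_1)
    moreover have "\<psi> P \<noteq> 0" using that(1) 1 unfolding fraction_def by auto
    moreover have "\<psi>' v = inverse (\<psi>' u)" using 1 by (metis inverse_unique)
    ultimately show ?thesis using that(1) unfolding fraction_def by simp
  qed
  have "\<exists>P Q. fraction u P Q" using assms(11)
  proof (induction u rule: Z0_induct)
    case (const c)
    have "fraction (weyl2_const c) (weyl2_const c) 1"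
      unfolding fraction_def by (simp add: one R_const Z0_pointD[OF \<psi>] Z0_pointD[OF \<psi>'])
    then show ?case by blast
  next
    case (gen u)
    note inverses = inv[OF gens(1) gen_inverse(1) gen_Z0(1,7)] inv[OF gens(3) gen_inverse(2) gen_Z0(2,8)]
      inv[OF gens(5) gen_inverse(3) gen_Z0(3,9)] inv[OF gens(2) gen_inverse(4) gen_Z0(4,10)]
      inv[OF gens(4) gen_inverse(5) gen_Z0(5,11)] inv[OF gens(6) gen_inverse(6) gen_Z0(6,12)]
    from gen gens inverses show ?case by auto
  next
    case (add u v)
    then obtain P Q P' Q' where f: "fraction u P Q" "fraction v P' Q'" by blast
    have "R (P * Q' + P' * Q) = \<iota> (u + v) * R (Q * Q')"
    proof -
      have "R (P * Q' + P' * Q) = R P * R Q' + R P' * R Q"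
        using f by (simp add: fraction_def R_simps Z0_closed)
      also have "\<dots> = \<iota> u * (R Q * R Q') + \<iota> v * (R Q' * R Q)"
        using f by (simp add: fraction_def mult.assoc)
      also have "R Q' * R Q = R Q * R Q'" using f by (intro Z0_hom_commute[OF R_hom]) (auto simp: fraction_def)
      finally show ?thesis
        using f add by (simp add: fraction_def R_simps \<iota>_simps distrib_right)
    qed
    then have "fraction (u + v) (P * Q' + P' * Q) (Q * Q')"
      using f add by (simp add: fraction_def Z0_closed Z0_pointD[OF \<psi>] Z0_pointD[OF \<psi>'] add_frac_eq)
    then show ?case by blast
  next
    case (mult u v)
    then obtain P Q P' Q' where f: "fraction u P Q" "fraction v P' Q'" by blast
    have "R (P * P') = \<iota> (u * v) * R (Q * Q')"
    proof -
      have "R (P * P') = R P' * R P"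
        using f Z0_hom_commute[OF R_hom, of P P'] by (simp add: fraction_def R_simps)
      also have "\<dots> = \<iota> v * (R Q' * R P)" using f by (simp add: fraction_def mult.assoc)
      also have "R Q' * R P = R P * R Q'" using f by (intro Z0_hom_commute[OF R_hom]) (auto simp: fraction_def)
      also have "\<iota> v * (R P * R Q') = \<iota> v * \<iota> u * (R Q * R Q')"
        using f by (simp add: fraction_def mult.assoc)
      also have "\<iota> v * \<iota> u = \<iota> (u * v)" using mult \<iota>_commute[of u v] by (simp add: \<iota>_simps)
      finally show ?thesis using f by (simp add: fraction_def R_simps)
    qed
    then have "fraction (u * v) (P * P') (Q * Q')"
      using f mult by (simp add: fraction_def Z0_closed Z0_pointD[OF \<psi>] Z0_pointD[OF \<psi>'])
    then show ?case by blast
  qed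
  then obtain P Q where f: "fraction u P Q" by blast
  then have "Q \<noteq> 0" using Z0_pointD(2)[OF \<psi>] by (auto simp: fraction_def)
  with f show ?thesis
    using RW_inverse_eq[of P Q u] unfolding fraction_def has_value_at_def by metis
qed

end

theorem theorem3p6:
  fixes N :: nat
    and \<iota> R :: "weyl2 \<Rightarrow> 'd::division_ring"
    and \<chi>1 \<chi>2 \<chi>1' \<chi>2' :: "weyl \<Rightarrow> complex"
  assumes "N \<ge> 2"
    and "is_weyl2_fractions (xi_root N) \<iota>"
    and "is_RW (xi_root N) \<iota> R"
    and "is_character N \<chi>1" "is_character N \<chi>2" "is_character N \<chi>1'" "is_character N \<chi>2'"
    and "braiding_defined (character_coords N \<chi>1) (character_coords N \<chi>2)"
  shows "braiding (character_coords N \<chi>1) (character_coords N \<chi>2)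
           = (character_coords N \<chi>2', character_coords N \<chi>1') \<longleftrightarrow>
         (\<forall>u\<in>weyl2_Z0 N.
            has_value_at N \<iota> (RW_inverse N \<iota> R (\<iota> u)) (character_tensor \<chi>1 \<chi>2)
              (character_tensor \<chi>1' \<chi>2' u))"
proof -
  interpret weyl2_R N \<iota> R using assms(1-3) by unfold_locales
  define \<psi> \<psi>' where "\<psi> = character_tensor \<chi>1 \<chi>2" and "\<psi>' = character_tensor \<chi>1' \<chi>2'"
  have p: "Z0_point \<psi>" "Z0_point \<psi>'"
    using assms(4-7) by (simp_all add: \<psi>_def \<psi>'_def Z0_point_character_tensor)
  note nz = Z0_point_gen(7-)[OF p(1)]
  have c: "character_coords N \<chi>1 = (\<psi> xx1, \<psi> yy1, \<psi> zz1)"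
    "character_coords N \<chi>2 = (\<psi> xx2, \<psi> yy2, \<psi> zz2)"
    "character_coords N \<chi>1' = (\<psi>' xx1, \<psi>' yy1, \<psi>' zz1)"
    "character_coords N \<chi>2' = (\<psi>' xx2, \<psi>' yy2, \<psi>' zz2)"
    using assms(4-7) by (simp_all add: character_coords_def \<psi>_def \<psi>'_def character_tensor_gen)
  define A where "A = 1 - \<psi> zz1 * \<psi> yy1 / \<psi> yy2 * (1 - \<psi> xx1 / \<psi> zz1) * (1 - 1 / (\<psi> zz2 * \<psi> xx2))"
  define D where "D = 1 - \<psi> zz2 * \<psi> xx2 * (1 - \<psi> yy2 / (\<psi> zz1 * \<psi> yy1))"
  \<comment> \<open>These are the two denominators of the braiding formulas that are not products of
    coordinates; up to nonzero coordinates they are the values of \<open>num_A\<close> and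
    \<open>den_b1\<close> at \<psi>.\<close>
  have AD: "A \<noteq> 0" "D \<noteq> 0"
    using assms(8) by (simp_all add: c braiding_defined_def braiding_A_def A_def D_def)
  note eval = Z0_pointD[OF p(1)] Z0_closed num_defs
  have numA: "\<psi> num_A = A * (\<psi> yy2 * \<psi> zz2 * \<psi> xx2)"
    using nz by (simp add: A_def eval field_simps)
  have denb1: "\<psi> den_b1 = D * (\<psi> zz1 * \<psi> yy1)"
    using nz by (simp add: D_def eval field_simps)
  have den: "\<psi> den_b1 \<noteq> 0" "\<psi> num_A \<noteq> 0" using AD nz by (simp_all add: numA denb1)
  have "braiding (character_coords N \<chi>1) (character_coords N \<chi>2)
      = ((\<psi> num_A / \<psi> (yy2 * zz2), \<psi> num_b2 / \<psi> xx1, \<psi> zz2),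
         (\<psi> (xx1 * xx2 * yy2 * zz2) / \<psi> num_A, \<psi> (zz2 * yy2 * yy1) / \<psi> den_b1, \<psi> zz1))"
  proof -
    have "\<psi> xx2 * A = \<psi> num_A / \<psi> (yy2 * zz2)"
      unfolding numA using nz by (simp add: eval)
    moreover have "\<psi> xx1 * inverse A = \<psi> (xx1 * xx2 * yy2 * zz2) / \<psi> num_A"
      unfolding numA using nz AD by (simp add: eval field_simps)
    moreover have "\<psi> zz2 * \<psi> yy2 / \<psi> zz1 * inverse D = \<psi> (zz2 * yy2 * yy1) / \<psi> den_b1"
      unfolding denb1 using nz AD by (simp add: eval field_simps)
    moreover have "\<psi> yy1 * (1 - \<psi> zz1 / \<psi> xx1 * (1 - \<psi> yy2 / (\<psi> zz1 * \<psi> yy1))) = \<psi> num_b2 / \<psi> xx1"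
      using nz by (simp add: eval field_simps)
    moreover have "braiding_A (\<psi> xx1, \<psi> yy1, \<psi> zz1) (\<psi> xx2, \<psi> yy2, \<psi> zz2) = A"
      by (simp add: braiding_A_def A_def)
    ultimately show ?thesis
      unfolding c braiding_def Let_def prod.case D_def by simp
  qed
  then have "braiding (character_coords N \<chi>1) (character_coords N \<chi>2)
           = (character_coords N \<chi>2', character_coords N \<chi>1') \<longleftrightarrow>
      \<psi>' xx1 = \<psi> (xx1 * xx2 * yy2 * zz2) / \<psi> num_A \<and> \<psi>' xx2 = \<psi> num_A / \<psi> (yy2 * zz2) \<and>
      \<psi>' yy1 = \<psi> (zz2 * yy2 * yy1) / \<psi> den_b1 \<and> \<psi>' yy2 = \<psi> num_b2 / \<psi> xx1 \<and>
      \<psi>' zz1 = \<psi> zz1 \<and> \<psi>' zz2 = \<psi> zz2"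
    unfolding c by auto
  also have "\<dots> \<longleftrightarrow> (\<forall>u\<in>Z0. val (RW_inverse N \<iota> R (\<iota> u)) \<psi> (\<psi>' u))"
  proof (intro iffI ballI)
    assume *: "\<forall>u\<in>Z0. val (RW_inverse N \<iota> R (\<iota> u)) \<psi> (\<psi>' u)"
    \<comment> \<open>For this direction the six generators suffice: values are unique, so each
      coordinate of \<psi>' must be the value of the corresponding P / Q.\<close>
    have v: "\<psi>' u = \<psi> P / \<psi> Q"
      if "R P = \<iota> u * R Q" "u \<in> Z0" "P \<in> Z0" "Q \<in> Z0" "\<psi> Q \<noteq> 0" for u P Q
      using value_RW_inverse_imp[OF p(1) that(3-5,1)] * that(2) by blast
    show "\<psi>' xx1 = \<psi> (xx1 * xx2 * yy2 * zz2) / \<psi> num_A \<and> \<psi>' xx2 = \<psi> num_A / \<psi> (yy2 * zz2) \<and>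
      \<psi>' yy1 = \<psi> (zz2 * yy2 * yy1) / \<psi> den_b1 \<and> \<psi>' yy2 = \<psi> num_b2 / \<psi> xx1 \<and>
      \<psi>' zz1 = \<psi> zz1 \<and> \<psi>' zz2 = \<psi> zz2"
      using R_equations[THEN v] den nz by (simp add: Z0_closed Z0_pointD[OF p(1)])
  qed (use value_RW_inverse[OF p den] in blast)
  finally show ?thesis by (simp only: \<psi>_def \<psi>'_def)
qed

end
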